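(* For every integer $k>2$, as $n\to\infty$, \[n^{\frac{1}{k}n-o(n)}\leq H_n(C_{2k})\leq n^{\left(1-\frac{1}{3k} \right)n+o(n)}.\]
   Context: Two graphs on the same vertex set are called $G$-creating if the union of their edge sets contains $G$ as a (not necessarily induced) subgraph. $H_n(G)$ denotes the maximum number of Hamiltonian paths of the complete graph $K_n$ that are pairwise $G$-creating. $C_{2k}$ is the cycle of length $2k$. *)

theory Defs
  imports Complex_Main "HOL-Library.Landau_Symbols"
begin

text \<open>A simple graph is a pair of a vertex set and a set of edges, the edges being two-element
  sets of vertices.\<close>

type_synonym 'a graph = "'a set \<times> 'a set set"

abbreviation verts :: "'a graph \<Rightarrow> 'a set" where "verts \<equiv> fst"
abbreviation edges :: "'a graph \<Rightarrow> 'a set set" where "edges \<equiv> snd"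

definition complete_graph :: "nat \<Rightarrow> nat graph" where
  "complete_graph n = ({1..n}, {e. e \<subseteq> {1..n} \<and> card e = 2})"

text \<open>The cycle of length \<open>m\<close>; meant for \<open>m \<ge> 3\<close>.\<close>

definition cycle_graph :: "nat \<Rightarrow> nat graph" where
  "cycle_graph m = ({..<m}, {{i, Suc i mod m} | i. i < m})"

definition contains_subgraph :: "'a graph \<Rightarrow> 'b graph \<Rightarrow> bool" where
  "contains_subgraph A G \<longleftrightarrow>
     (\<exists>\<phi>. inj_on \<phi> (verts G) \<and> \<phi> ` verts G \<subseteq> verts A \<and> (\<forall>e\<in>edges G. \<phi> ` e \<in> edges A))"

definition creating :: "'b graph \<Rightarrow> 'a graph \<Rightarrow> 'a graph \<Rightarrow> bool" where
  "creating G A B \<longleftrightarrow>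
     verts A = verts B \<and> contains_subgraph (verts A, edges A \<union> edges B) G"

definition path_graph :: "'a list \<Rightarrow> 'a graph" where
  "path_graph xs = (set xs, {{xs ! i, xs ! Suc i} | i. Suc i < length xs})"

text \<open>Hamiltonian paths are taken as subgraphs, so a vertex sequence and its reversal give the
  same path.\<close>

definition hamiltonian_paths :: "'a graph \<Rightarrow> 'a graph set" where
  "hamiltonian_paths A =
     {path_graph xs | xs. distinct xs \<and> set xs = verts A \<and> edges (path_graph xs) \<subseteq> edges A}"

definition creating_families :: "nat \<Rightarrow> 'b graph \<Rightarrow> nat graph set set" where
  "creating_families n G =
     {F. F \<subseteq> hamiltonian_paths (complete_graph n) \<and> pairwise (creating G) F}"

definition H :: "nat \<Rightarrow> 'b graph \<Rightarrow> nat" where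
  "H n G = Max (card ` creating_families n G)"

text \<open>The maximum ranges over a finite nonempty set, whose members are finite families.\<close>

lemma finite_hamiltonian_paths_complete_graph: "finite (hamiltonian_paths (complete_graph n))"
proof (rule finite_subset)
  show "hamiltonian_paths (complete_graph n) \<subseteq> {{1..n}} \<times> Pow (Pow {1..n})"
    by (fastforce simp: hamiltonian_paths_def complete_graph_def path_graph_def)
qed simp

lemma finite_creating_families: "finite (creating_families n G)"
  by (rule finite_subset[of _ "Pow (hamiltonian_paths (complete_graph n))"])
    (auto simp: creating_families_def finite_hamiltonian_paths_complete_graph)

lemma creating_families_nonempty: "creating_families n G \<noteq> {}"
  by (auto simp: creating_families_def intro!: exI[of _ "{}"])

end

theory Submission
  imports Defs "HOL-Combinatorics.Multiset_Permutations" "HOL-Real_Asymp.Real_Asymp"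
begin

text \<open>
  Lower bound: fix a sequence of about \<open>n / k\<close> separator vertices and as many blocks of \<open>k - 1\<close>
  vertices, and let a permutation decide which block is put between which consecutive separators.
  Two different permutations put different blocks into some gap, which closes a \<open>2k\<close>-cycle.

  Upper bound: if the union of any two members of a family \<open>S\<close> of Hamiltonian paths is free of
  \<open>2k\<close>-cycles, then by symmetry at most \<open>n! / |S|\<close> Hamiltonian paths are pairwise creating. Such an
  \<open>S\<close> comes from a random graph of average degree about \<open>n\<close> to the power \<open>1 / (3k)\<close>: it has only
  about \<open>n\<close> to the power \<open>2/3\<close> cycles of length \<open>2k\<close>, while its number of Hamiltonian paths is as
  large as expected. By pigeonhole, many of these paths use the same edges lying in \<open>2k\<close>-cycles;
  subdividing these few edges destroys all \<open>2k\<close>-cycles at the cost of \<open>o(n)\<close> new vertices.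
\<close>

section \<open>Path graphs and cycles\<close>

text \<open>Edges in the direction of traversal. The subdivision later on inserts new vertices
  behind the tail of an edge, so it has to know which end comes first.\<close>

definition steps :: "'a list \<Rightarrow> ('a \<times> 'a) set" where
  "steps xs = (\<lambda>i. (xs ! i, xs ! Suc i)) ` {i. Suc i < length xs}"

lemma edges_path_graph: "edges (path_graph xs) = (\<lambda>(x, y). {x, y}) ` steps xs"
  by (simp add: path_graph_def steps_def image_image setcompr_eq_image)

lemma steps_subset: "steps xs \<subseteq> set xs \<times> set xs"
  by (auto simp: steps_def)

lemma steps_map: "steps (map f xs) = map_prod f f ` steps xs"
  unfolding steps_def image_image by (rule image_cong) (auto dest: Suc_lessD)

lemma edges_path_graph_map: "edges (path_graph (map f xs)) = (`) f ` edges (path_graph xs)"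
  by (simp add: edges_path_graph steps_map image_image case_prod_beta)

lemma edges_path_graph_subset: "e \<in> edges (path_graph xs) \<Longrightarrow> e \<subseteq> set xs"
  using steps_subset[of xs] by (auto simp: edges_path_graph)

lemma steps_right_unique:
  assumes "distinct xs" "(x, y) \<in> steps xs" "(x, z) \<in> steps xs"
  shows "y = z"
  using assms by (auto simp: steps_def nth_eq_iff_index_eq)

lemma steps_left_unique:
  assumes "distinct xs" "(y, x) \<in> steps xs" "(z, x) \<in> steps xs"
  shows "y = z"
  using assms by (auto simp: steps_def nth_eq_iff_index_eq)

lemma last_not_step:
  assumes "distinct xs"
  shows "(last xs, y) \<notin> steps xs"
  using assms by (cases "xs = []") (auto simp: steps_def last_conv_nth nth_eq_iff_index_eq)

lemma card_edges_path_graph: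
  assumes "distinct xs"
  shows "card (edges (path_graph xs)) = length xs - 1"
proof -
  have "edges (path_graph xs) = (\<lambda>i. {xs ! i, xs ! Suc i}) ` {..<length xs - 1}"
    by (auto simp: path_graph_def)
  moreover have "inj_on (\<lambda>i. {xs ! i, xs ! Suc i}) {..<length xs - 1}"
    using assms by (auto simp: inj_on_def doubleton_eq_iff nth_eq_iff_index_eq)
  ultimately show ?thesis by (simp add: card_image)
qed

lemma contains_cycleE:
  assumes "contains_subgraph A (cycle_graph m)"
  obtains \<phi> where "inj_on \<phi> {..<m}" "\<phi> ` {..<m} \<subseteq> verts A"
    "\<And>i. i < m \<Longrightarrow> {\<phi> i, \<phi> (Suc i mod m)} \<in> edges A"
proof -
  obtain \<phi> where "inj_on \<phi> {..<m}" "\<phi> ` {..<m} \<subseteq> verts A"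
    and e: "\<forall>e\<in>{{i, Suc i mod m} | i. i < m}. \<phi> ` e \<in> edges A"
    using assms unfolding contains_subgraph_def cycle_graph_def fst_conv snd_conv by blast
  moreover have "{\<phi> i, \<phi> (Suc i mod m)} \<in> edges A" if "i < m" for i
    using bspec[OF e, of "{i, Suc i mod m}"] that by auto
  ultimately show ?thesis using that by blast
qed

lemma contains_cycleI:
  assumes "inj_on \<phi> {..<m}" "\<phi> ` {..<m} \<subseteq> verts A"
    "\<And>i. i < m \<Longrightarrow> {\<phi> i, \<phi> (Suc i mod m)} \<in> edges A"
  shows "contains_subgraph A (cycle_graph m)"
  unfolding contains_subgraph_def cycle_graph_def fst_conv snd_conv
  using assms by (intro exI[of _ \<phi>]) auto

text \<open>The vertex of the cycle that stands furthest along the path has both its cycle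
  neighbours directly before it on the path. So these coincide, which is impossible for length at
  least 3.\<close>

lemma path_graph_acyclic:
  assumes "distinct xs" "m \<ge> 3"
  shows "\<not> contains_subgraph (path_graph xs) (cycle_graph m)"
proof
  assume "contains_subgraph (path_graph xs) (cycle_graph m)"
  then obtain \<phi> where inj: "inj_on \<phi> {..<m}" and sub: "\<phi> ` {..<m} \<subseteq> set xs"
    and edge: "\<And>i. i < m \<Longrightarrow> {\<phi> i, \<phi> (Suc i mod m)} \<in> edges (path_graph xs)"
    unfolding path_graph_def by (elim contains_cycleE) (simp only: fst_conv snd_conv)
  have "\<forall>i\<in>{..<m}. \<exists>j<length xs. xs ! j = \<phi> i"
    using sub by (auto simp: in_set_conv_nth subset_iff)
  then obtain pos where pos: "\<And>i. i < m \<Longrightarrow> pos i < length xs \<and> xs ! pos i = \<phi> i"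
    by (metis lessThan_iff)
  have adj: "pos (Suc i mod m) = Suc (pos i) \<or> pos i = Suc (pos (Suc i mod m))" if "i < m" for i
  proof -
    have "Suc i mod m < m" using that by simp
    then show ?thesis
      using edge[OF that] pos[OF that] pos[of "Suc i mod m"] assms(1)
      by (auto simp: path_graph_def doubleton_eq_iff nth_eq_iff_index_eq)
  qed
  have injpos: "pos i = pos j \<Longrightarrow> i = j" if "i < m" "j < m" for i j
    using that pos inj by (metis inj_onD lessThan_iff)
  obtain i where i: "i < m" and top: "\<And>j. j < m \<Longrightarrow> pos j \<le> pos i"
  proof -
    have "Max (pos ` {..<m}) \<in> pos ` {..<m}" using assms(2) by (intro Max_in) (auto simp: lessThan_empty_iff)
    then obtain i where "i < m" "pos i = Max (pos ` {..<m})" by auto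
    moreover have "pos j \<le> Max (pos ` {..<m})" if "j < m" for j using that by auto
    ultimately show ?thesis using that by metis
  qed
  \<comment> \<open>\<open>j\<close> is the cyclic predecessor of \<open>i\<close>.\<close>
  define j where "j = (if i = 0 then m - 1 else i - 1)"
  have j: "j < m" "Suc j mod m = i" using i assms(2) by (auto simp: j_def)
  have "Suc i mod m < m" using i by simp
  with adj[OF i] top[of "Suc i mod m"] have 1: "pos i = Suc (pos (Suc i mod m))" by auto
  from j top[OF j(1)] adj[OF j(1)] have 2: "pos i = Suc (pos j)" by auto
  have "j = Suc i mod m" using injpos[OF j(1) \<open>Suc i mod m < m\<close>] 1 2 by simp
  then show False using i assms(2) by (cases "Suc i = m") (auto simp: j_def split: if_splits)
qed

lemma steps_Nil [simp]: "steps [] = {}"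
  and steps_single [simp]: "steps [x] = {}"
  by (simp_all add: steps_def)

lemma steps_Cons_Cons [simp]: "steps (x # y # zs) = insert (x, y) (steps (y # zs))"
proof -
  have "{i. Suc i < length (x # y # zs)} = insert 0 (Suc ` {i. Suc i < length (y # zs)})"
    by (auto simp: image_iff less_Suc_eq_0_disj)
  then show ?thesis unfolding steps_def by (simp only: image_insert image_image nth_Cons_0 nth_Cons_Suc)
qed

lemma steps_append:
  "us \<noteq> [] \<Longrightarrow> vs \<noteq> [] \<Longrightarrow> steps (us @ vs) = steps us \<union> {(last us, hd vs)} \<union> steps vs"
proof (induction us rule: induct_list012)
  case (2 x)
  then show ?case by (cases vs) auto
qed auto

section \<open>Lower bound\<close>

lemma card_le_H:
  assumes "F \<in> creating_families n G"
  shows "card F \<le> H n G"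
  unfolding H_def using assms finite_creating_families[of n G] by (intro Max_ge) auto

text \<open>The multiples of \<open>k\<close> are the separators, and the \<open>k - 1\<close>
  numbers after each of them form a block. Blocks move as a whole; separators and everything from
  \<open>k * N\<close> on stay in place.\<close>

definition block_shuffle :: "nat \<Rightarrow> nat \<Rightarrow> (nat \<Rightarrow> nat) \<Rightarrow> nat \<Rightarrow> nat" where
  "block_shuffle k N \<sigma> t =
     (if t mod k = 0 \<or> k * N \<le> t then t else k * \<sigma> (t div k) + t mod k)"

lemma block_shuffle_inverse:
  assumes "\<sigma> permutes {..<N}" "k > 0"
  shows "block_shuffle k N (inv \<sigma>) (block_shuffle k N \<sigma> t) = t"
proof (cases "t mod k = 0 \<or> k * N \<le> t")
  case False
  then have "t div k < N" using assms(2) by (simp add: less_mult_imp_div_less mult.commute)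
  then have "\<sigma> (t div k) < N" using permutes_in_image[OF assms(1), of "t div k"] by simp
  then have "k * Suc (\<sigma> (t div k)) \<le> k * N" by (intro mult_le_mono2) simp
  then have "k * \<sigma> (t div k) + t mod k < k * N"
    using mod_less_divisor[OF assms(2), of t] by simp
  then show ?thesis
    using False assms by (auto simp: block_shuffle_def permutes_inverses)
qed (auto simp: block_shuffle_def)

lemma block_shuffle_bij:
  assumes "\<sigma> permutes {..<N}" "k > 0" "k * N \<le> n"
  shows "bij_betw (block_shuffle k N \<sigma>) {..<n} {..<n}"
proof (intro bij_betw_byWitness[where f' = "block_shuffle k N (inv \<sigma>)"])
  have *: "block_shuffle k N \<tau> ` {..<n} \<subseteq> {..<n}" if "\<tau> permutes {..<N}" for \<tau>
  proof (rule image_subsetI)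
    fix t assume t: "t \<in> {..<n}"
    show "block_shuffle k N \<tau> t \<in> {..<n}"
    proof (cases "t mod k = 0 \<or> k * N \<le> t")
      case False
      then have "t div k < N" using assms(2) by (simp add: less_mult_imp_div_less mult.commute)
      then have "\<tau> (t div k) < N" using permutes_in_image[OF that, of "t div k"] by simp
      then have "k * Suc (\<tau> (t div k)) \<le> k * N" by (intro mult_le_mono2) simp
      then have "k * \<tau> (t div k) + t mod k < k * N"
        using mod_less_divisor[OF assms(2), of t] by simp
      then show ?thesis using False assms(3) by (simp add: block_shuffle_def)
    qed (use t in \<open>simp add: block_shuffle_def\<close>)
  qed
  show "block_shuffle k N \<sigma> ` {..<n} \<subseteq> {..<n}" "block_shuffle k N (inv \<sigma>) ` {..<n} \<subseteq> {..<n}"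
    using * assms(1) permutes_inv by blast+
  show "\<forall>a\<in>{..<n}. block_shuffle k N (inv \<sigma>) (block_shuffle k N \<sigma> a) = a"
    using block_shuffle_inverse[OF assms(1,2)] by blast
  show "\<forall>a\<in>{..<n}. block_shuffle k N \<sigma> (block_shuffle k N (inv \<sigma>) a) = a"
    using block_shuffle_inverse[OF permutes_inv[OF assms(1)] assms(2)]
    by (simp add: permutes_inv_inv[OF assms(1)])
qed

definition shuffled_path :: "nat \<Rightarrow> nat \<Rightarrow> nat \<Rightarrow> (nat \<Rightarrow> nat) \<Rightarrow> nat list" where
  "shuffled_path n k N \<sigma> = map (\<lambda>t. Suc (block_shuffle k N \<sigma> t)) [0..<n]"

lemma shuffled_path_permutation:
  assumes "\<sigma> permutes {..<N}" "k > 0" "k * N \<le> n"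
  shows "distinct (shuffled_path n k N \<sigma>)" "set (shuffled_path n k N \<sigma>) = {1..n}"
proof -
  note b = block_shuffle_bij[OF assms]
  show "distinct (shuffled_path n k N \<sigma>)"
    using b by (auto simp: shuffled_path_def distinct_map bij_betw_def inj_on_def atLeast0LessThan)
  have "set (shuffled_path n k N \<sigma>) = Suc ` (block_shuffle k N \<sigma> ` {..<n})"
    by (auto simp: shuffled_path_def)
  also have "\<dots> = {1..n}" using b by (simp add: bij_betw_def image_Suc_lessThan)
  finally show "set (shuffled_path n k N \<sigma>) = {1..n}" .
qed

lemma hamiltonian_pathI:
  assumes "distinct xs" "set xs = {1..n}"
  shows "path_graph xs \<in> hamiltonian_paths (complete_graph n)"
proof -
  have "edges (path_graph xs) \<subseteq> edges (complete_graph n)"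
  proof
    fix e assume e: "e \<in> edges (path_graph xs)"
    then have "card e = 2"
      using assms(1) by (auto simp: path_graph_def card_insert_if nth_eq_iff_index_eq)
    then show "e \<in> edges (complete_graph n)"
      using edges_path_graph_subset[OF e] assms(2) by (simp add: complete_graph_def)
  qed
  then show ?thesis using assms by (auto simp: hamiltonian_paths_def complete_graph_def)
qed

lemma shuffled_path_edge:
  assumes "Suc t < n"
  shows "{Suc (block_shuffle k N \<sigma> t), Suc (block_shuffle k N \<sigma> (Suc t))}
    \<in> edges (path_graph (shuffled_path n k N \<sigma>))"
proof -
  have "shuffled_path n k N \<sigma> ! t = Suc (block_shuffle k N \<sigma> t)"
    "shuffled_path n k N \<sigma> ! Suc t = Suc (block_shuffle k N \<sigma> (Suc t))"
    "length (shuffled_path n k N \<sigma>) = n"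
    using assms by (simp_all add: shuffled_path_def del: upt_Suc)
  then show ?thesis unfolding path_graph_def snd_conv mem_Collect_eq using assms by metis
qed

text \<open>Where \<open>\<sigma>\<close> and \<open>\<tau>\<close> place different blocks, both paths join the same two separators,
  by two internally disjoint paths with \<open>k\<close> edges each.\<close>

lemma shuffled_paths_create_cycle:
  assumes perm: "\<sigma> permutes {..<N}" "\<tau> permutes {..<N}" and "\<sigma> \<noteq> \<tau>" and k: "k > 0" and n: "k * N < n"
  shows "creating (cycle_graph (2 * k)) (path_graph (shuffled_path n k N \<sigma>))
    (path_graph (shuffled_path n k N \<tau>))"
proof -
  let ?S = "block_shuffle k N \<sigma>" and ?T = "block_shuffle k N \<tau>"
  let ?P = "shuffled_path n k N \<sigma>" and ?Q = "shuffled_path n k N \<tau>"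
  have n': "k * N \<le> n" using n by simp
  obtain i where i: "\<sigma> i \<noteq> \<tau> i" using \<open>\<sigma> \<noteq> \<tau>\<close> by auto
  then have "i < N" using perm by (metis lessThan_iff permutes_not_in)
  then have "k * Suc i \<le> k * N" by (intro mult_le_mono2) simp
  then have iN: "k * i + k \<le> k * N" by simp
  \<comment> \<open>The cycle runs from separator \<open>k * i\<close> to separator
    \<open>k * i + k\<close> along the first path and returns along the second, hence the offset
    \<open>2 * k - r\<close>.\<close>
  define \<phi> where "\<phi> r = (if r \<le> k then Suc (?S (k * i + r)) else Suc (?T (k * i + (2 * k - r))))" for r
  have injS: "inj_on ?S {..<n}" and injT: "inj_on ?T {..<n}"
    using block_shuffle_bij[OF _ k n'] perm by (auto simp: bij_betw_def)
  have ends: "?S (k * i) = k * i" "?T (k * i) = k * i" "?S (k * i + k) = k * i + k" "?T (k * i + k) = k * i + k"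
    using k by (auto simp: block_shuffle_def)
  have int: "?S (k * i + r) = k * \<sigma> i + r" "?T (k * i + r) = k * \<tau> i + r" if "0 < r" "r < k" for r
    using that iN by (auto simp: block_shuffle_def)
  \<comment> \<open>An inner vertex of the way back differs from everything on the way out: its
    residue modulo \<open>k\<close> is nonzero, unlike that of a separator, and its quotient is
    \<open>\<tau> i\<close> rather than \<open>\<sigma> i\<close>.\<close>
  have cross: "?S (k * i + r) \<noteq> ?T (k * i + s)" if "r \<le> k" "0 < s" "s < k" for r s
  proof
    assume eq: "?S (k * i + r) = ?T (k * i + s)"
    show False
    proof (cases "r = 0 \<or> r = k")
      case True
      then have "?S (k * i + r) mod k = 0" using ends by auto
      moreover have "?T (k * i + s) mod k = s" using int(2)[of s] that by simp
      ultimately show False using eq that by simp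
    next
      case False
      then have "k * \<sigma> i + r = k * \<tau> i + s" using int(1)[of r] int(2)[of s] that eq by simp
      then have "(k * \<sigma> i + r) div k = (k * \<tau> i + s) div k" by simp
      then show False using False that i k by simp
    qed
  qed
  have "inj_on \<phi> {..<2 * k}"
  proof (rule inj_onI)
    fix r s assume rs: "r \<in> {..<2 * k}" "s \<in> {..<2 * k}" "\<phi> r = \<phi> s"
    consider "r \<le> k" "s \<le> k" | "r \<le> k" "s > k" | "r > k" "s \<le> k" | "r > k" "s > k" by linarith
    then show "r = s"
    proof cases
      case 1
      then have "?S (k * i + r) = ?S (k * i + s)" using rs by (simp add: \<phi>_def)
      then show ?thesis using inj_onD[OF injS, of "k * i + r" "k * i + s"] 1 iN n by simp
    next
      case 2
      then have "?S (k * i + r) = ?T (k * i + (2 * k - s))" using rs by (simp add: \<phi>_def)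
      moreover have "0 < 2 * k - s" "2 * k - s < k" using 2 rs by auto
      ultimately show ?thesis using cross[of r "2 * k - s"] 2 by blast
    next
      case 3
      then have "?S (k * i + s) = ?T (k * i + (2 * k - r))" using rs by (simp add: \<phi>_def)
      moreover have "0 < 2 * k - r" "2 * k - r < k" using 3 rs by auto
      ultimately show ?thesis using cross[of s "2 * k - r"] 3 by blast
    next
      case 4
      then have "?T (k * i + (2 * k - r)) = ?T (k * i + (2 * k - s))" using rs by (simp add: \<phi>_def)
      then have "k * i + (2 * k - r) = k * i + (2 * k - s)"
      proof (rule inj_onD[OF injT])
        have "k * i + (2 * k - t) < n" if "t > k" for t using that iN n by linarith
        then show "k * i + (2 * k - r) \<in> {..<n}" "k * i + (2 * k - s) \<in> {..<n}" using 4 by simp_all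
      qed
      then show ?thesis using rs by auto
    qed
  qed
  moreover have "\<phi> ` {..<2 * k} \<subseteq> {1..n}"
  proof safe
    fix r assume "r < 2 * k"
    have "?S t < n \<and> ?T t < n" if "t < n" for t
      using that block_shuffle_bij[OF _ k n'] perm by (auto simp: bij_betw_def)
    moreover have "k * i + r < n" if "r \<le> k" for r using that iN n by linarith
    moreover have "2 * k - r \<le> k" if "\<not> r \<le> k" using that by simp
    ultimately show "\<phi> r \<in> {1..n}" by (simp add: \<phi>_def Suc_le_eq)
  qed
  moreover have "{\<phi> r, \<phi> (Suc r mod (2 * k))} \<in> edges (path_graph ?P) \<union> edges (path_graph ?Q)"
    if "r < 2 * k" for r
  proof (cases "r < k")
    case True
    then have "Suc r mod (2 * k) = Suc r" by simp
    then have "{\<phi> r, \<phi> (Suc r mod (2 * k))} = {Suc (?S (k * i + r)), Suc (?S (Suc (k * i + r)))}"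
      using True by (simp add: \<phi>_def)
    moreover have "Suc (k * i + r) < n" using True iN n by linarith
    ultimately show ?thesis using shuffled_path_edge[of "k * i + r" n] by simp
  next
    case False
    \<comment> \<open>The second half is walked backwards: edge number \<open>r\<close> of the cycle
      joins the offsets \<open>Suc s\<close> and \<open>s\<close> of the second path.\<close>
    define s where "s = 2 * k - Suc r"
    have s: "s < k" "Suc s = 2 * k - r" using False that by (auto simp: s_def)
    have "\<phi> r = Suc (?T (Suc (k * i + s)))"
    proof (cases "r = k")
      case True
      then show ?thesis using ends s by (simp add: \<phi>_def flip: add_Suc_right)
    next
      case False
      then show ?thesis using s \<open>\<not> r < k\<close> by (simp add: \<phi>_def flip: add_Suc_right)
    qed
    moreover have "\<phi> (Suc r mod (2 * k)) = Suc (?T (k * i + s))"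
    proof (cases "Suc r = 2 * k")
      case True
      then show ?thesis using ends by (simp add: \<phi>_def s_def)
    next
      case False
      then have "Suc r mod (2 * k) = Suc r" using that by simp
      then show ?thesis using \<open>\<not> r < k\<close> by (simp add: \<phi>_def s_def)
    qed
    moreover have "Suc (k * i + s) < n" using s iN n by linarith
    ultimately show ?thesis using shuffled_path_edge[of "k * i + s" n] by (simp add: insert_commute)
  qed
  ultimately have "contains_subgraph ({1..n}, edges (path_graph ?P) \<union> edges (path_graph ?Q))
      (cycle_graph (2 * k))"
    by (intro contains_cycleI[of \<phi>]) simp_all
  then show ?thesis
    using shuffled_path_permutation[OF perm(1) k n'] shuffled_path_permutation[OF perm(2) k n']
    by (simp add: creating_def path_graph_def)
qed

text \<open>Different permutations give different paths, since the union of two equal paths is a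
  path and has no cycle. Strictness in \<open>k * N < n\<close> provides the last separator.\<close>

lemma fact_le_H_cycle:
  assumes "k \<ge> 2" "k * N < n"
  shows "fact N \<le> H n (cycle_graph (2 * k))"
proof -
  let ?p = "\<lambda>\<sigma>. path_graph (shuffled_path n k N \<sigma>)" and ?S = "{\<sigma>. \<sigma> permutes {..<N}}"
  have k: "k > 0" "k * N \<le> n" "2 * k \<ge> 3" using assms by auto
  note perm = shuffled_path_permutation[OF _ k(1,2)]
  have inj: "inj_on ?p ?S"
  proof (rule inj_onI, rule ccontr)
    fix \<sigma> \<tau> assume *: "\<sigma> \<in> ?S" "\<tau> \<in> ?S" "?p \<sigma> = ?p \<tau>" "\<sigma> \<noteq> \<tau>"
    then have "creating (cycle_graph (2 * k)) (?p \<sigma>) (?p \<sigma>)"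
      using shuffled_paths_create_cycle[of \<sigma> N \<tau> k n] assms(2) k(1) by simp
    then show False
      using path_graph_acyclic[OF perm(1) k(3), of \<sigma>] *(1) by (simp add: creating_def)
  qed
  have "?p ` ?S \<in> creating_families n (cycle_graph (2 * k))"
  proof -
    have "?p \<sigma> \<in> hamiltonian_paths (complete_graph n)" if "\<sigma> permutes {..<N}" for \<sigma>
      using perm[OF that] by (intro hamiltonian_pathI)
    moreover have "creating (cycle_graph (2 * k)) (?p \<sigma>) (?p \<tau>)"
      if "\<sigma> permutes {..<N}" "\<tau> permutes {..<N}" "?p \<sigma> \<noteq> ?p \<tau>" for \<sigma> \<tau>
      using that assms(2) k by (intro shuffled_paths_create_cycle) blast+
    ultimately show ?thesis
      unfolding creating_families_def pairwise_def by blast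
  qed
  from card_le_H[OF this] show ?thesis
    using inj by (simp add: card_image card_permutations)
qed

section \<open>The double counting bound\<close>

text \<open>A path \<open>P\<close> of an optimal family and a list \<open>q\<close> in
  \<open>S\<close> determine the bijection from \<open>W\<close> to \<open>{1..n}\<close> that
  carries \<open>q\<close> to \<open>P\<close>. Suppose that \<open>P\<close>, \<open>q\<close> and
  \<open>P'\<close>, \<open>q'\<close> share it. If \<open>P\<close> and \<open>P'\<close> differed,
  their union would contain \<open>G\<close>, and pulling back would give \<open>G\<close> in the
  union of \<open>q\<close> and \<open>q'\<close>. So \<open>P = P'\<close>, and then
  \<open>q = q'\<close>. Hence there are at most \<open>fact n\<close> pairs.\<close>

lemma H_mult_card_le_fact:
  fixes S :: "'a list set" and G :: "'b graph"
  assumes W: "finite W" "card W = n" and S: "S \<subseteq> permutations_of_set W"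
    and free: "\<And>xs ys. xs \<in> S \<Longrightarrow> ys \<in> S \<Longrightarrow>
      \<not> contains_subgraph (W, edges (path_graph xs) \<union> edges (path_graph ys)) G"
  shows "H n G * card S \<le> fact n"
proof -
  have "Max (card ` creating_families n G) \<in> card ` creating_families n G"
    using finite_creating_families[of n G] creating_families_nonempty[of n G] by (intro Max_in) auto
  then obtain F where F: "F \<in> creating_families n G" "card F = H n G"
    by (auto simp: H_def)
  have "\<exists>xs. distinct xs \<and> set xs = {1..n} \<and> path_graph xs = P" if "P \<in> F" for P
    using F(1) that by (auto simp: creating_families_def hamiltonian_paths_def complete_graph_def)
  \<comment> \<open>A path comes from a vertex sequence and from its reversal; \<open>l\<close>
    fixes one choice.\<close>
  then obtain l where l: "\<And>P. P \<in> F \<Longrightarrow> distinct (l P) \<and> set (l P) = {1..n} \<and> path_graph (l P) = P"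
    by metis
  obtain ws where ws: "distinct ws" "set ws = W" using finite_distinct_list[OF W(1)] by blast
  \<comment> \<open>The map that matches the entries of \<open>q\<close> and \<open>l P\<close>
    position by position.\<close>
  define \<pi> where "\<pi> P q = (\<lambda>w. the (map_of (zip q (l P)) w))" for P and q :: "'a list"
  have map_\<pi>: "map (\<pi> P q) q = l P" if "P \<in> F" "q \<in> S" for P q
  proof (rule nth_equalityI)
    have q: "distinct q" "set q = W" using S that by (auto simp: permutations_of_set_def)
    have "length q = n" using distinct_card[OF q(1)] q(2) W(2) by simp
    moreover have "length (l P) = n" using distinct_card[of "l P"] l[OF that(1)] by simp
    ultimately have len: "length (l P) = length q" by simp
    then show "length (map (\<pi> P q) q) = length (l P)" by simp
    fix i assume "i < length (map (\<pi> P q) q)"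
    then show "map (\<pi> P q) q ! i = l P ! i"
      using map_of_zip_nth[OF len[symmetric] q(1), of i] len by (simp add: \<pi>_def)
  qed
  have perm: "inj_on (\<pi> P q) W" "\<pi> P q ` W = {1..n}" if "P \<in> F" "q \<in> S" for P q
  proof -
    have "set q = W" using S that by (auto simp: permutations_of_set_def)
    moreover have "distinct (map (\<pi> P q) q)" "set (map (\<pi> P q) q) = {1..n}"
      using map_\<pi>[OF that] l[OF that(1)] by simp_all
    ultimately show "inj_on (\<pi> P q) W" "\<pi> P q ` W = {1..n}" by (simp_all add: distinct_map)
  qed
  \<comment> \<open>A bijection is recorded by its values along the fixed enumeration
    \<open>ws\<close>; this turns it into a permutation of \<open>{1..n}\<close>.\<close>
  let ?\<Phi> = "\<lambda>(P, q). map (\<pi> P q) ws"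
  have "inj_on ?\<Phi> (F \<times> S)"
  proof (intro inj_onI, clarify)
    fix P q P' q' assume PF: "P \<in> F" "P' \<in> F" and qS: "q \<in> S" "q' \<in> S"
      and eq: "map (\<pi> P q) ws = map (\<pi> P' q') ws"
    define f where "f = \<pi> P q"
    have sets: "set q = W" "set q' = W" using S qS by (auto simp: permutations_of_set_def)
    have "\<pi> P' q' w = f w" if "w \<in> W" for w using eq that ws(2) by (simp add: f_def)
    then have q': "map f q' = l P'" using map_\<pi>[OF PF(2) qS(2)] sets(2) map_cong[of q' q' "\<pi> P' q'" f] by simp
    have q: "map f q = l P" using map_\<pi>[OF PF(1) qS(1)] by (simp add: f_def)
    have f: "inj_on f W" "f ` W = {1..n}" using perm[OF PF(1) qS(1)] by (simp_all add: f_def)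
    have "P = P'"
    proof (rule ccontr)
      assume "P \<noteq> P'"
      then have "creating G P P'"
        using F(1) PF unfolding creating_families_def mem_Collect_eq by (blast dest: pairwiseD)
      moreover have "verts P = {1..n}"
      proof -
        have "verts (path_graph (l P)) = set (l P)" by (simp add: path_graph_def)
        then show ?thesis using l[OF PF(1)] by simp
      qed
      ultimately obtain \<phi> where \<phi>: "inj_on \<phi> (verts G)" "\<phi> ` verts G \<subseteq> {1..n}"
        "\<And>e. e \<in> edges G \<Longrightarrow> \<phi> ` e \<in> edges P \<union> edges P'"
        unfolding creating_def contains_subgraph_def fst_conv snd_conv by metis
      define g where "g = inv_into W f"
      have g: "inj_on g {1..n}" "g ` {1..n} = W"
        using bij_betw_inv_into[of f W "{1..n}"] f unfolding g_def bij_betw_def by simp_all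
      have edges: "g ` e \<in> edges (path_graph p)" if "e \<in> edges (path_graph (map f p))" "set p = W" for e p
      proof -
        from that(1) obtain e' where e': "e' \<in> edges (path_graph p)" "e = f ` e'"
          by (auto simp: edges_path_graph_map)
        then have "e' \<subseteq> W" using edges_path_graph_subset that(2) by blast
        then have "g ` e = e'" unfolding e'(2) g_def using f(1) by (simp add: inv_into_image_cancel)
        then show ?thesis using e'(1) by simp
      qed
      have PP: "P = path_graph (map f q)" "P' = path_graph (map f q')"
        using l PF q q' by simp_all
      have "contains_subgraph (W, edges (path_graph q) \<union> edges (path_graph q')) G"
        unfolding contains_subgraph_def fst_conv snd_conv
      proof (intro exI[of _ "g \<circ> \<phi>"] conjI ballI)
        show "inj_on (g \<circ> \<phi>) (verts G)" using \<phi> g(1) by (blast intro: comp_inj_on inj_on_subset)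
        show "(g \<circ> \<phi>) ` verts G \<subseteq> W" using \<phi>(2) g(2) by (auto simp: image_comp[symmetric])
        fix e assume "e \<in> edges G"
        then show "(g \<circ> \<phi>) ` e \<in> edges (path_graph q) \<union> edges (path_graph q')"
          using \<phi>(3)[of e] edges[of "\<phi> ` e" q] edges[of "\<phi> ` e" q'] sets PP
          unfolding image_comp[symmetric] by blast
      qed
      then show False using free qS by blast
    qed
    moreover have "q = q'"
    proof -
      have "map f q = map f q'" using q q' \<open>P = P'\<close> by simp
      then show ?thesis using f(1) sets by (simp add: inj_on_map_eq_map)
    qed
    ultimately show "P = P' \<and> q = q'" ..
  qed
  moreover have "?\<Phi> ` (F \<times> S) \<subseteq> permutations_of_set {1..n}"
    using perm ws by (auto simp: permutations_of_set_def distinct_map)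
  ultimately have "card (F \<times> S) \<le> card (permutations_of_set {1..n})"
    by (intro card_inj_on_le[of ?\<Phi>]) auto
  then show ?thesis using F(2) by (simp add: card_cartesian_product)
qed

section \<open>Random graphs with few cycles and many Hamiltonian paths\<close>

definition cycle_edges :: "'a list \<Rightarrow> 'a set set" where
  "cycle_edges zs = (\<lambda>i. {zs ! i, zs ! (Suc i mod length zs)}) ` {..<length zs}"

text \<open>A cycle of length \<open>l \<ge> 3\<close> appears once for every starting point and
  direction, that is \<open>2 * l\<close> times. All counts of cycles below include this constant
  factor.\<close>

definition cycle_lists :: "nat \<Rightarrow> 'a set \<Rightarrow> 'a list set" where
  "cycle_lists l V = {zs. length zs = l \<and> distinct zs \<and> set zs \<subseteq> V}"

lemma finite_cycle_lists: "finite V \<Longrightarrow> finite (cycle_lists l V)"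
  by (rule finite_subset[OF _ finite_lists_length_eq[of V l]]) (auto simp: cycle_lists_def)

text \<open>The starting point of a cycle can thus be moved until a chosen edge is the one that
  closes the list.\<close>

lemma cycle_edges_rotate: "cycle_edges (rotate r zs) = cycle_edges zs"
proof (cases "zs = []")
  case False
  define l where "l = length zs"
  have l: "l > 0" using False by (simp add: l_def)
  let ?e = "\<lambda>i. {zs ! i, zs ! (Suc i mod l)}"
  have "cycle_edges (rotate r zs) = (\<lambda>i. ?e ((r + i) mod l)) ` {..<l}"
    unfolding cycle_edges_def length_rotate l_def[symmetric]
  proof (rule image_cong[OF refl])
    fix i assume "i \<in> {..<l}"
    then show "{rotate r zs ! i, rotate r zs ! (Suc i mod l)} = ?e ((r + i) mod l)"
      using l by (simp add: nth_rotate l_def mod_simps)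
  qed
  also have "\<dots> = ?e ` ((\<lambda>i. (r + i) mod l) ` {..<l})" by (simp add: image_image)
  also have "(\<lambda>i. (r + i) mod l) ` {..<l} = {..<l}"
  proof
    show "{..<l} \<subseteq> (\<lambda>i. (r + i) mod l) ` {..<l}"
    proof
      fix j assume "j \<in> {..<l}"
      then have j: "j < l" by simp
      \<comment> \<open>The preimage of \<open>j\<close> is \<open>j - r\<close> modulo
        \<open>l\<close>, written so that no subtraction is truncated at 0.\<close>
      have "(r + (j + (l - r mod l)) mod l) mod l = (r mod l + (j + (l - r mod l))) mod l"
        by (simp only: mod_add_left_eq mod_add_right_eq)
      also have "r mod l + (j + (l - r mod l)) = j + l" using mod_less_divisor[OF l, of r] by linarith
      finally have "j = (r + (j + (l - r mod l)) mod l) mod l" using j by simp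
      then show "j \<in> (\<lambda>i. (r + i) mod l) ` {..<l}" by (rule image_eqI) (use l in simp)
    qed
  qed (use l in auto)
  finally show ?thesis by (simp add: cycle_edges_def l_def)
qed simp

text \<open>Two different indices with the same edge would be cyclic successors of each other, which
  needs length at most 2.\<close>

lemma inj_on_cycle_edges:
  assumes "distinct zs" "length zs \<ge> 3"
  shows "inj_on (\<lambda>i. {zs ! i, zs ! (Suc i mod length zs)}) {..<length zs}"
proof (rule inj_onI)
  define l where "l = length zs"
  fix i j assume "i \<in> {..<length zs}" "j \<in> {..<length zs}"
    and eq: "{zs ! i, zs ! (Suc i mod length zs)} = {zs ! j, zs ! (Suc j mod length zs)}"
  then have ij: "i < l" "j < l" by (auto simp: l_def)
  then have s: "Suc i mod l < l" "Suc j mod l < l" by simp_all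
  have "i = j \<or> (i = Suc j mod l \<and> Suc i mod l = j)"
    using eq ij s assms(1) by (auto simp: doubleton_eq_iff nth_eq_iff_index_eq simp flip: l_def)
  moreover have "\<not> (i = Suc j mod l \<and> Suc i mod l = j)"
  proof
    assume "i = Suc j mod l \<and> Suc i mod l = j"
    then show False using ij assms(2) unfolding l_def[symmetric]
      by (cases "Suc i = l"; cases "Suc j = l") auto
  qed
  ultimately show "i = j" by blast
qed

lemma cycle_edges_not_subset_path:
  assumes "distinct xs" "distinct zs" "set zs \<subseteq> set xs" "length zs \<ge> 3"
  shows "\<not> cycle_edges zs \<subseteq> edges (path_graph xs)"
proof
  assume *: "cycle_edges zs \<subseteq> edges (path_graph xs)"
  have "contains_subgraph (path_graph xs) (cycle_graph (length zs))"
  proof (rule contains_cycleI[of "nth zs"])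
    show "inj_on (nth zs) {..<length zs}" using assms(2) by (simp add: inj_on_nth)
    show "nth zs ` {..<length zs} \<subseteq> verts (path_graph xs)"
      using assms(3) by (auto simp: path_graph_def)
    show "{zs ! i, zs ! (Suc i mod length zs)} \<in> edges (path_graph xs)" if "i < length zs" for i
      using * that by (auto simp: cycle_edges_def)
  qed
  then show False using path_graph_acyclic[OF assms(1,4)] by simp
qed

section \<open>Expected number of cycles given a Hamiltonian path\<close>

lemma card_path_neighbours:
  assumes "distinct xs"
  shows "card {y. {x, y} \<in> edges (path_graph xs)} \<le> 2"
proof -
  let ?R = "{y. (x, y) \<in> steps xs}" and ?L = "{y. (y, x) \<in> steps xs}"
  have sub: "{y. {x, y} \<in> edges (path_graph xs)} \<subseteq> ?R \<union> ?L"
    by (auto simp: edges_path_graph doubleton_eq_iff)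
  have fin: "finite ?R" "finite ?L"
    using steps_subset[of xs] by (auto intro: finite_subset[of _ "set xs"])
  have "card ?R \<le> 1" "card ?L \<le> 1"
    using fin steps_right_unique[OF assms] steps_left_unique[OF assms]
    by (auto simp: card_le_Suc0_iff_eq)
  moreover have "card {y. {x, y} \<in> edges (path_graph xs)} \<le> card (?R \<union> ?L)"
    using sub fin by (intro card_mono) auto
  ultimately show ?thesis using card_Un_le[of ?R ?L] by linarith
qed

lemma sum_image_Cons:
  "(\<Sum>zs\<in>(\<lambda>(y, zs). y # zs) ` (V \<times> A). F zs) = (\<Sum>y\<in>V. \<Sum>zs\<in>A. F (y # zs))"
proof -
  have "inj_on (\<lambda>(y, zs). y # zs) (V \<times> A)" by (auto simp: inj_on_def)
  then have "(\<Sum>zs\<in>(\<lambda>(y, zs). y # zs) ` (V \<times> A). F zs) = sum (F \<circ> (\<lambda>(y, zs). y # zs)) (V \<times> A)"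
    by (rule sum.reindex)
  also have "F \<circ> (\<lambda>(y, zs). y # zs) = (\<lambda>(y, zs). F (y # zs))" by auto
  finally show ?thesis by (simp add: sum.cartesian_product)
qed

text \<open>Peeling off the first step of a walk costs a factor of at most \<open>D\<close>.\<close>

lemma sum_walk_weight_le:
  fixes w :: "'a \<Rightarrow> 'a \<Rightarrow> real"
  assumes V: "finite V" and w: "\<And>x y. w x y \<ge> 0" and D: "\<And>x. x \<in> V \<Longrightarrow> (\<Sum>y\<in>V. w x y) \<le> D" and "D \<ge> 0"
    and "x \<in> V"
  shows "(\<Sum>zs | set zs \<subseteq> V \<and> length zs = L. \<Prod>i<L. w ((x # zs) ! i) (zs ! i)) \<le> D ^ L"
  using \<open>x \<in> V\<close>
proof (induction L arbitrary: x)
  case 0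
  have "{zs. set zs \<subseteq> V \<and> length zs = 0} = {[]}" by auto
  then show ?case by simp
next
  case (Suc L)
  let ?A = "{zs. set zs \<subseteq> V \<and> length zs = L}"
  have "(\<Sum>zs | set zs \<subseteq> V \<and> length zs = Suc L. \<Prod>i<Suc L. w ((x # zs) ! i) (zs ! i)) =
      (\<Sum>zs\<in>(\<lambda>(y, zs). y # zs) ` (V \<times> ?A). \<Prod>i<Suc L. w ((x # zs) ! i) (zs ! i))"
    by (rule sum.cong) (auto simp: length_Suc_conv image_iff)
  also have "\<dots> = (\<Sum>y\<in>V. \<Sum>zs\<in>?A. \<Prod>i<Suc L. w ((x # y # zs) ! i) ((y # zs) ! i))"
    by (rule sum_image_Cons)
  also have "\<dots> = (\<Sum>y\<in>V. w x y * (\<Sum>zs\<in>?A. \<Prod>i<L. w ((y # zs) ! i) (zs ! i)))"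
    by (simp add: prod.lessThan_Suc_shift sum_distrib_left del: prod.lessThan_Suc)
  also have "\<dots> \<le> (\<Sum>y\<in>V. w x y * D ^ L)"
    using Suc.IH w by (intro sum_mono mult_left_mono) auto
  also have "\<dots> = (\<Sum>y\<in>V. w x y) * D ^ L" by (simp add: sum_distrib_right)
  also have "\<dots> \<le> D * D ^ L" using D[OF Suc.prems] \<open>D \<ge> 0\<close> by (intro mult_right_mono) auto
  finally show ?case by simp
qed

text \<open>The sum is the expected number of \<open>l\<close>-cycles in a random graph conditioned
  on containing the path. Each step of a walk follows one of at most 2 path edges, of weight 1, or
  another edge, of weight \<open>p\<close>, with total weight at most \<open>D\<close>. As paths are
  acyclic, every cycle has an edge off the path; some rotation makes it the closing edge, and trying
  all rotations gives the factor \<open>l\<close>.\<close>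

lemma sum_cycles_given_path_le:
  fixes p :: real
  assumes xs: "xs \<in> permutations_of_set V" and p: "0 < p" "p \<le> 1" and l: "l \<ge> 3"
  defines "D \<equiv> 2 + real (card V) * p"
  shows "(\<Sum>zs\<in>cycle_lists l V. p ^ card (cycle_edges zs - edges (path_graph xs))) \<le> real l * D ^ l"
proof -
  define A where "A = edges (path_graph xs)"
  have xs': "distinct xs" "set xs = V" using xs by (auto simp: permutations_of_set_def)
  have V: "finite V" using xs'(2) by auto
  have fin: "finite (cycle_lists l V)" using V by (rule finite_cycle_lists)
  define w where "w x y = (if {x, y} \<in> A then 1 else p)" for x y
  define g where "g zs = p ^ card (cycle_edges zs - A)" for zs
  define Z where "Z = {zs \<in> cycle_lists l V. {zs ! (l - 1), zs ! 0} \<notin> A}"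
  have D: "(\<Sum>y\<in>V. w x y) \<le> D" for x
  proof -
    have "(\<Sum>y\<in>V. w x y) \<le> (\<Sum>y\<in>V. (if y \<in> {y. {x, y} \<in> A} then 1 else 0) + p)"
      using p by (intro sum_mono) (auto simp: w_def)
    also have "\<dots> = real (card (V \<inter> {y. {x, y} \<in> A})) + real (card V) * p"
      using V by (simp add: sum.distrib sum.If_cases)
    also have "\<dots> \<le> D"
    proof -
      have "y \<in> V" if "{x, y} \<in> A" for y
        using edges_path_graph_subset[of "{x, y}" xs] that xs'(2) by (simp add: A_def)
      then have "V \<inter> {y. {x, y} \<in> A} = {y. {x, y} \<in> A}" by blast
      then have "card (V \<inter> {y. {x, y} \<in> A}) \<le> 2"
        using card_path_neighbours[OF xs'(1), of x] by (simp add: A_def)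
      then show ?thesis by (simp add: D_def)
    qed
    finally show ?thesis .
  qed
  have g_eq: "g zs = p * (\<Prod>i<l-1. w (zs ! i) (tl zs ! i))" if "zs \<in> Z" for zs
  proof -
    have zs: "length zs = l" "distinct zs" "{zs ! (l - 1), zs ! 0} \<notin> A"
      using that by (auto simp: Z_def cycle_lists_def)
    let ?e = "\<lambda>i. {zs ! i, zs ! (Suc i mod l)}"
    have "cycle_edges zs - A = ?e ` {i\<in>{..<l}. ?e i \<notin> A}"
      by (auto simp: cycle_edges_def zs(1))
    moreover have "inj_on ?e {i\<in>{..<l}. ?e i \<notin> A}"
    proof (rule inj_on_subset)
      show "inj_on ?e {..<l}" using inj_on_cycle_edges[OF zs(2)] zs(1) l by simp
    qed blast
    ultimately have "card (cycle_edges zs - A) = card {i\<in>{..<l}. ?e i \<notin> A}"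
      by (simp only: card_image)
    then have "g zs = (\<Prod>i\<in>{i\<in>{..<l}. ?e i \<notin> A}. p)" by (simp add: g_def)
    also have "\<dots> = (\<Prod>i<l. if ?e i \<notin> A then p else 1)" by (rule prod.inter_filter) simp
    also have "\<dots> = (\<Prod>i<Suc (l - 1). if ?e i \<notin> A then p else 1)" using l by simp
    also have "\<dots> = p * (\<Prod>i<l-1. if ?e i \<notin> A then p else 1)"
    proof -
      have "?e (l - 1) \<notin> A" using l zs(3) by simp
      then show ?thesis unfolding prod.lessThan_Suc by (simp only: if_True not_False_eq_True mult.commute)
    qed
    also have "(\<Prod>i<l-1. if ?e i \<notin> A then p else 1) = (\<Prod>i<l-1. w (zs ! i) (tl zs ! i))"
      using l zs(1) by (intro prod.cong refl) (auto simp: w_def nth_tl)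
    finally show ?thesis .
  qed
  have sumZ: "(\<Sum>zs\<in>Z. g zs) \<le> D ^ l"
  proof -
    let ?A = "{zs. set zs \<subseteq> V \<and> length zs = l - 1}"
    have "Z \<subseteq> (\<lambda>(x, zs). x # zs) ` (V \<times> ?A)"
    proof
      fix zs assume "zs \<in> Z"
      then show "zs \<in> (\<lambda>(x, zs). x # zs) ` (V \<times> ?A)"
        using l by (cases zs) (auto simp: Z_def cycle_lists_def)
    qed
    moreover have finA: "finite (V \<times> ?A)" using V finite_lists_length_eq[OF V, of "l - 1"] by simp
    moreover have pos: "(\<Prod>i<l-1. w (zs ! i) (tl zs ! i)) \<ge> 0" for zs
      using p by (intro prod_nonneg) (auto simp: w_def)
    ultimately have "(\<Sum>zs\<in>Z. \<Prod>i<l-1. w (zs ! i) (tl zs ! i)) \<le>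
        (\<Sum>zs\<in>(\<lambda>(x, zs). x # zs) ` (V \<times> ?A). \<Prod>i<l-1. w (zs ! i) (tl zs ! i))"
      by (intro sum_mono2) auto
    also have "\<dots> = (\<Sum>x\<in>V. \<Sum>zs\<in>?A. \<Prod>i<l-1. w ((x # zs) ! i) (zs ! i))"
      by (simp add: sum_image_Cons)
    also have "\<dots> \<le> (\<Sum>x\<in>V. D ^ (l - 1))"
      using V D p by (intro sum_mono sum_walk_weight_le) (auto simp: w_def D_def)
    also have "\<dots> = real (card V) * D ^ (l - 1)" by simp
    finally have "(\<Sum>zs\<in>Z. g zs) \<le> p * (real (card V) * D ^ (l - 1))"
      using p by (simp add: g_eq flip: sum_distrib_left cong: sum.cong)
    also have "\<dots> = (real (card V) * p) * D ^ (l - 1)" by simp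
    \<comment> \<open>The \<open>card V\<close> starting points and the weight \<open>p\<close> of
      the closing edge together cost one more factor \<open>D\<close>.\<close>
    also have "\<dots> \<le> D * D ^ (l - 1)" using p by (intro mult_right_mono) (auto simp: D_def)
    also have "\<dots> = D ^ l" using l by (simp flip: power_Suc)
    finally show ?thesis .
  qed
  have rot: "\<exists>r<l. rotate r zs \<in> Z" if "zs \<in> cycle_lists l V" for zs
  proof -
    have zs: "length zs = l" "distinct zs" "set zs \<subseteq> set xs"
      using that xs' by (auto simp: cycle_lists_def)
    then obtain i where i: "i < l" "{zs ! i, zs ! (Suc i mod l)} \<notin> A"
      using cycle_edges_not_subset_path[OF xs'(1) zs(2,3)] l by (auto simp: cycle_edges_def A_def)
    \<comment> \<open>Starting right after the off-path edge makes it the closing edge.\<close>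
    have "rotate (Suc i mod l) zs ! 0 = zs ! (Suc i mod l)"
      using nth_rotate[of 0 zs "Suc i mod l"] i zs(1) l by simp
    moreover have "(Suc i mod l + (l - 1)) mod l = i"
    proof -
      have "(Suc i mod l + (l - 1)) mod l = (Suc i + (l - 1)) mod l" by (rule mod_add_left_eq)
      also have "Suc i + (l - 1) = i + l" using l by simp
      finally show ?thesis using i by simp
    qed
    then have "rotate (Suc i mod l) zs ! (l - 1) = zs ! i"
      using nth_rotate[of "l - 1" zs "Suc i mod l"] i zs(1) l by simp
    ultimately have "rotate (Suc i mod l) zs \<in> Z"
      using i(2) zs xs' by (auto simp: Z_def cycle_lists_def)
    then show ?thesis using i by (intro exI[of _ "Suc i mod l"]) auto
  qed
  have g0: "g zs \<ge> 0" for zs using p by (simp add: g_def)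
  have "(\<Sum>zs\<in>cycle_lists l V. g zs) \<le>
      (\<Sum>zs\<in>cycle_lists l V. \<Sum>r<l. if rotate r zs \<in> Z then g zs else 0)"
  proof (rule sum_mono)
    fix zs assume "zs \<in> cycle_lists l V"
    then obtain r where "r < l" "rotate r zs \<in> Z" using rot by blast
    then show "g zs \<le> (\<Sum>r<l. if rotate r zs \<in> Z then g zs else 0)"
      using member_le_sum[of r "{..<l}" "\<lambda>r. if rotate r zs \<in> Z then g zs else 0"] g0 by simp
  qed
  also have "\<dots> = (\<Sum>r<l. \<Sum>zs\<in>cycle_lists l V. if rotate r zs \<in> Z then g zs else 0)"
    by (rule sum.swap)
  also have "\<dots> = (\<Sum>r<l. \<Sum>zs | zs \<in> cycle_lists l V \<and> rotate r zs \<in> Z. g zs)"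
    using fin by (simp only: sum.inter_filter)
  also have "\<dots> \<le> (\<Sum>r<l. D ^ l)"
  proof (rule sum_mono)
    fix r
    let ?X = "{zs. zs \<in> cycle_lists l V \<and> rotate r zs \<in> Z}"
    have "inj_on (rotate r) ?X"
    proof (rule inj_onI)
      fix xs ys assume "xs \<in> ?X" "ys \<in> ?X" "rotate r xs = rotate r ys"
      \<comment> \<open>Rotation by \<open>l * r - r\<close> undoes rotation by \<open>r\<close>,
        since \<open>l * r\<close> positions amount to whole turns.\<close>
      moreover have "rotate (l * r - r) (rotate r zs) = zs" if "zs \<in> ?X" for zs
      proof -
        have "r \<le> l * r" using l by simp
        then have "rotate (l * r - r) (rotate r zs) = rotate (l * r) zs"
          by (simp add: rotate_rotate)
        also have "\<dots> = zs" using that by (intro rotate_id) (simp add: cycle_lists_def)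
        finally show ?thesis .
      qed
      ultimately show "xs = ys" by metis
    qed
    have "(\<Sum>zs\<in>?X. g zs) = (\<Sum>zs\<in>?X. g (rotate r zs))" by (simp add: g_def cycle_edges_rotate)
    also have "\<dots> = (\<Sum>zs\<in>rotate r ` ?X. g zs)" using \<open>inj_on (rotate r) ?X\<close> by (simp add: sum.reindex)
    also have "\<dots> \<le> (\<Sum>zs\<in>Z. g zs)"
      using fin g0 by (intro sum_mono2) (auto simp: Z_def)
    also have "\<dots> \<le> D ^ l" by (rule sumZ)
    finally show "(\<Sum>zs\<in>?X. g zs) \<le> D ^ l" .
  qed
  finally show ?thesis by (simp add: g_def A_def)
qed

section \<open>Random edge sets with binomial weights\<close>

lemma sum_binomial_weight_Pow:
  fixes p :: real
  assumes "finite E"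
  shows "(\<Sum>X\<in>Pow E. p ^ card X * (1 - p) ^ card (E - X)) = 1"
  using prod_add[OF assms, of "\<lambda>_. p" "\<lambda>_. 1 - p"] by simp

text \<open>The weight is the probability of \<open>Q\<close> as a random subset of \<open>E\<close>
  with density \<open>p\<close>. Once \<open>R\<close> is contained, the rest of \<open>Q\<close> is
  a random subset of \<open>E - R\<close>, whose weights sum to 1.\<close>

lemma sum_binomial_weight_supersets:
  fixes p :: real
  assumes "finite E" "R \<subseteq> E"
  shows "(\<Sum>Q\<in>Pow E. p ^ card Q * (1 - p) ^ card (E - Q) * of_bool (R \<subseteq> Q)) = p ^ card R"
proof -
  have fin: "finite R" using assms finite_subset by blast
  have "(\<Sum>Q\<in>Pow E. p ^ card Q * (1 - p) ^ card (E - Q) * of_bool (R \<subseteq> Q)) =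
      (\<Sum>Q\<in>(\<union>) R ` Pow (E - R). p ^ card Q * (1 - p) ^ card (E - Q) * of_bool (R \<subseteq> Q))"
  proof (rule sum.mono_neutral_right)
    show "(\<union>) R ` Pow (E - R) \<subseteq> Pow E" using assms(2) by auto
    show "\<forall>Q\<in>Pow E - (\<union>) R ` Pow (E - R). p ^ card Q * (1 - p) ^ card (E - Q) * of_bool (R \<subseteq> Q) = 0"
    proof
      fix Q assume Q: "Q \<in> Pow E - (\<union>) R ` Pow (E - R)"
      have "\<not> R \<subseteq> Q"
      proof
        assume "R \<subseteq> Q"
        then have "Q = R \<union> (Q - R)" "Q - R \<in> Pow (E - R)" using Q by auto
        then show False using Q by blast
      qed
      then show "p ^ card Q * (1 - p) ^ card (E - Q) * of_bool (R \<subseteq> Q) = 0" by simp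
    qed
  qed (use assms in simp)
  also have "\<dots> = (\<Sum>X\<in>Pow (E - R). p ^ card (R \<union> X) * (1 - p) ^ card (E - (R \<union> X)))"
  proof (subst sum.reindex)
    show "inj_on ((\<union>) R) (Pow (E - R))" by (rule inj_onI) blast
  qed simp
  also have "\<dots> = (\<Sum>X\<in>Pow (E - R). p ^ card R * (p ^ card X * (1 - p) ^ card (E - R - X)))"
  proof (rule sum.cong[OF refl])
    fix X assume X: "X \<in> Pow (E - R)"
    then have "finite X" using assms(1) by (meson PowD finite_Diff finite_subset)
    moreover have "R \<inter> X = {}" using X by blast
    ultimately have "card (R \<union> X) = card R + card X" using fin by (simp add: card_Un_disjoint)
    moreover have "E - (R \<union> X) = E - R - X" by blast
    ultimately show "p ^ card (R \<union> X) * (1 - p) ^ card (E - (R \<union> X)) =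
        p ^ card R * (p ^ card X * (1 - p) ^ card (E - R - X))"
      by (simp add: power_add)
  qed
  also have "\<dots> = p ^ card R"
    using sum_binomial_weight_Pow[of "E - R" p] assms(1) by (simp flip: sum_distrib_left)
  finally show ?thesis .
qed

definition ham_lists :: "'a set \<Rightarrow> 'a set set \<Rightarrow> 'a list set" where
  "ham_lists V Q = {xs \<in> permutations_of_set V. edges (path_graph xs) \<subseteq> Q}"

definition cycles_in :: "nat \<Rightarrow> 'a set \<Rightarrow> 'a set set \<Rightarrow> 'a list set" where
  "cycles_in l V Q = {zs \<in> cycle_lists l V. cycle_edges zs \<subseteq> Q}"

text \<open>In a random graph with edge probability \<open>p\<close>, the expected number of \<open>l\<close>-cycles conditioned
  on containing a given Hamiltonian path is at most \<open>B\<close>. Hence the sum over all graphs \<open>Q\<close> of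
  \<open>\<mu> Q * h Q * (2 * B - c Q)\<close>, with \<open>h\<close> and \<open>c\<close> counting Hamiltonian paths and \<open>l\<close>-cycles, is at
  least \<open>B\<close> times the expectation of \<open>h\<close>.\<close>

lemma exists_graph_few_cycles_many_ham_lists:
  fixes V :: "'a set" and p :: real
  assumes V: "finite V" and p: "0 < p" "p < 1" and l: "l \<ge> 3"
  defines "B \<equiv> real l * (2 + real (card V) * p) ^ l"
  obtains Q where "real (card (cycles_in l V Q)) < 2 * B"
    "fact (card V) * p ^ (card V - 1) \<le> 2 * real (card (ham_lists V Q))"
proof -
  define E where "E = {e. e \<subseteq> V \<and> card e = 2}"
  have E: "finite E" using V unfolding E_def by (rule finite_subset[rotated, OF finite_Pow_iff[THEN iffD2]]) auto
  define M where "M = permutations_of_set V"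
  define Z where "Z = cycle_lists l V"
  define P where "P xs = edges (path_graph xs)" for xs :: "'a list"
  define \<mu> where "\<mu> Q = p ^ card Q * (1 - p) ^ card (E - Q)" for Q
  define h where "h Q = (\<Sum>xs\<in>M. of_bool (P xs \<subseteq> Q) :: real)" for Q
  define c where "c Q = (\<Sum>zs\<in>Z. of_bool (cycle_edges zs \<subseteq> Q) :: real)" for Q
  have fin: "finite M" "finite Z" using V by (auto simp: M_def Z_def finite_cycle_lists)
  have M: "distinct xs" "set xs = V" "length xs = card V" if "xs \<in> M" for xs
    using that by (auto simp: M_def permutations_of_set_def distinct_card)
  have PE: "P xs \<subseteq> E" if "xs \<in> M" for xs
  proof
    fix e assume e: "e \<in> P xs"
    then have "card e = 2"
      using M(1)[OF that] by (auto simp: P_def path_graph_def card_insert_if nth_eq_iff_index_eq)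
    moreover have "e \<subseteq> V" using edges_path_graph_subset[of e xs] e M(2)[OF that] by (simp add: P_def)
    ultimately show "e \<in> E" by (simp add: E_def)
  qed
  have ZE: "cycle_edges zs \<subseteq> E" if "zs \<in> Z" for zs
  proof
    fix e assume e: "e \<in> cycle_edges zs"
    have zs: "distinct zs" "length zs = l" "set zs \<subseteq> V" using that by (auto simp: Z_def cycle_lists_def)
    from e obtain i where i: "i < l" "e = {zs ! i, zs ! (Suc i mod l)}"
      unfolding cycle_edges_def zs(2) by blast
    have si: "Suc i mod l < l" using i by simp
    have "Suc i mod l \<noteq> i" using i(1) l by (cases "Suc i = l") auto
    then have "zs ! i \<noteq> zs ! (Suc i mod l)" using zs i si by (simp add: nth_eq_iff_index_eq)
    moreover have "zs ! i \<in> V" "zs ! (Suc i mod l) \<in> V" using zs i si nth_mem by blast+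
    ultimately show "e \<in> E" by (simp add: E_def i(2))
  qed
  have cardP: "card (P xs) = card V - 1" if "xs \<in> M" for xs
    using card_edges_path_graph[OF M(1)[OF that]] M(3)[OF that] by (simp add: P_def)
  \<comment> \<open>The expected number of Hamiltonian paths, counted as lists: each list has
    \<open>card V - 1\<close> edges.\<close>
  define K where "K = fact (card V) * p ^ (card V - 1)"
  have "card M = fact (card V)" using V by (simp add: M_def)
  then have K: "K = (\<Sum>xs\<in>M. p ^ (card V - 1))" by (simp add: K_def)
  have sup: "(\<Sum>Q\<in>Pow E. \<mu> Q * of_bool (R \<subseteq> Q)) = p ^ card R" if "R \<subseteq> E" for R
    unfolding \<mu>_def using sum_binomial_weight_supersets[OF E that] .
  have "(\<Sum>Q\<in>Pow E. \<mu> Q * h Q) = (\<Sum>xs\<in>M. \<Sum>Q\<in>Pow E. \<mu> Q * of_bool (P xs \<subseteq> Q))"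
    unfolding h_def sum_distrib_left by (rule sum.swap)
  also have "\<dots> = K" unfolding K by (rule sum.cong[OF refl]) (simp only: sup[OF PE] cardP)
  finally have S1: "(\<Sum>Q\<in>Pow E. \<mu> Q * h Q) = K" .
  have "(\<Sum>Q\<in>Pow E. \<mu> Q * (h Q * c Q)) =
      (\<Sum>Q\<in>Pow E. \<Sum>xs\<in>M. \<Sum>zs\<in>Z. \<mu> Q * of_bool (P xs \<union> cycle_edges zs \<subseteq> Q))"
  proof (rule sum.cong[OF refl])
    fix Q
    have "\<mu> Q * (h Q * c Q) =
        (\<Sum>xs\<in>M. \<Sum>zs\<in>Z. \<mu> Q * (of_bool (P xs \<subseteq> Q) * of_bool (cycle_edges zs \<subseteq> Q)))"
      unfolding h_def c_def sum_product by (simp only: sum_distrib_left)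
    then show "\<mu> Q * (h Q * c Q) =
        (\<Sum>xs\<in>M. \<Sum>zs\<in>Z. \<mu> Q * of_bool (P xs \<union> cycle_edges zs \<subseteq> Q))"
      by (simp only: Un_subset_iff of_bool_conj)
  qed
  also have "\<dots> = (\<Sum>xs\<in>M. \<Sum>zs\<in>Z. \<Sum>Q\<in>Pow E. \<mu> Q * of_bool (P xs \<union> cycle_edges zs \<subseteq> Q))"
    by (subst sum.swap) (intro sum.cong refl sum.swap)
  \<comment> \<open>The probability of containing both path and cycle depends on the size of the
    union only. Splitting off the path leaves the probability of the cycle conditioned on the
    path.\<close>
  also have "\<dots> = (\<Sum>xs\<in>M. \<Sum>zs\<in>Z. p ^ (card V - 1) * p ^ card (cycle_edges zs - P xs))"
  proof (intro sum.cong refl)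
    fix xs zs assume "xs \<in> M" "zs \<in> Z"
    then have sub: "P xs \<union> cycle_edges zs \<subseteq> E" using PE ZE by blast
    then have "finite (P xs)" "finite (cycle_edges zs)" using E by (auto intro: finite_subset)
    then have "card (P xs \<union> cycle_edges zs) = card (P xs) + card (cycle_edges zs - P xs)"
      by (subst card_Un_disjoint[symmetric]) auto
    then show "(\<Sum>Q\<in>Pow E. \<mu> Q * of_bool (P xs \<union> cycle_edges zs \<subseteq> Q)) =
        p ^ (card V - 1) * p ^ card (cycle_edges zs - P xs)"
      unfolding sup[OF sub] using cardP[OF \<open>xs \<in> M\<close>] by (simp add: power_add)
  qed
  also have "\<dots> = (\<Sum>xs\<in>M. p ^ (card V - 1) * (\<Sum>zs\<in>Z. p ^ card (cycle_edges zs - P xs)))"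
    by (simp only: sum_distrib_left)
  also have "\<dots> \<le> (\<Sum>xs\<in>M. p ^ (card V - 1) * B)"
    using sum_cycles_given_path_le[of _ V p l] p l
    by (intro sum_mono mult_left_mono) (auto simp: M_def Z_def P_def B_def)
  also have "\<dots> = K * B" unfolding K sum_distrib_right ..
  finally have S2: "(\<Sum>Q\<in>Pow E. \<mu> Q * (h Q * c Q)) \<le> K * B" .
  \<comment> \<open>The weights \<open>\<mu>\<close> sum to 1 and the mean of
    \<open>h Q * (2 * B - c Q)\<close> is at least \<open>2 * B * K - K * B\<close>, so some
    \<open>Q\<close> reaches \<open>K * B\<close>.\<close>
  have "\<exists>Q\<in>Pow E. K * B \<le> h Q * (2 * B - c Q)"
  proof (rule ccontr)
    assume "\<not> ?thesis"
    then have less: "h Q * (2 * B - c Q) < K * B" if "Q \<in> Pow E" for Q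
      using that by (meson not_le)
    have "\<mu> Q > 0" for Q using p by (simp add: \<mu>_def)
    then have "(\<Sum>Q\<in>Pow E. \<mu> Q * (h Q * (2 * B - c Q))) < (\<Sum>Q\<in>Pow E. \<mu> Q * (K * B))"
      using E less by (intro sum_strict_mono mult_strict_left_mono) auto
    also have "\<dots> = (\<Sum>Q\<in>Pow E. \<mu> Q) * (K * B)" by (simp only: sum_distrib_right)
    also have "(\<Sum>Q\<in>Pow E. \<mu> Q) = 1" unfolding \<mu>_def by (rule sum_binomial_weight_Pow[OF E])
    also have "(\<Sum>Q\<in>Pow E. \<mu> Q * (h Q * (2 * B - c Q))) =
        2 * B * (\<Sum>Q\<in>Pow E. \<mu> Q * h Q) - (\<Sum>Q\<in>Pow E. \<mu> Q * (h Q * c Q))"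
      unfolding sum_distrib_left sum_subtractf[symmetric] by (intro sum.cong refl) (simp add: algebra_simps)
    finally show False using S1 S2 by (simp add: algebra_simps)
  qed
  then obtain Q where Q: "K * B \<le> h Q * (2 * B - c Q)" by blast
  have B: "B > 0"
  proof -
    have "2 + real (card V) * p > 0" using p by (simp add: add_pos_nonneg)
    then show ?thesis using l by (simp add: B_def)
  qed
  have Kpos: "K > 0" using p by (simp add: K_def)
  have h0: "h Q \<ge> 0" and c0: "c Q \<ge> 0" by (auto simp: h_def c_def intro: sum_nonneg)
  \<comment> \<open>One inequality yields both claims: positivity of the product forces
    \<open>c Q < 2 * B\<close>, and dropping \<open>c Q\<close> leaves
    \<open>K \<le> 2 * h Q\<close>.\<close>
  have "h Q * (2 * B - c Q) > 0" using Q B Kpos by (smt (verit) mult_pos_pos)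
  then have cQ: "c Q < 2 * B" using h0 by (smt (verit) mult_nonneg_nonpos)
  have "h Q * (2 * B - c Q) \<le> h Q * (2 * B)" using h0 c0 by (intro mult_left_mono) auto
  then have "K * B \<le> (2 * h Q) * B" using Q by simp
  then have hQ: "K \<le> 2 * h Q" using B by simp
  show ?thesis
  proof (rule that[of Q])
    have "c Q = real (card (cycles_in l V Q))"
      using fin(2) by (simp add: c_def cycles_in_def Z_def of_bool_def sum.If_cases Int_def)
    then show "real (card (cycles_in l V Q)) < 2 * B" using cQ by simp
    have "h Q = real (card (ham_lists V Q))"
      using fin(1) by (simp add: h_def ham_lists_def M_def P_def of_bool_def sum.If_cases Int_def)
    then show "fact (card V) * p ^ (card V - 1) \<le> 2 * real (card (ham_lists V Q))"
      using hQ by (simp add: K_def)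
  qed
qed

section \<open>Subdividing the edges on short cycles\<close>

text \<open>The edge leaving \<open>x\<close> is subdivided by \<open>d x\<close> new vertices, and
  the last entry receives a tail. As \<open>d\<close> depends on the vertex alone, lists over the
  same set inflate to lists over the same set.\<close>

definition inflate :: "('a \<Rightarrow> nat) \<Rightarrow> 'a list \<Rightarrow> ('a \<times> nat) list" where
  "inflate d xs = concat (map (\<lambda>x. map (Pair x) [0..<Suc (d x)]) xs)"

lemma inflate_Nil [simp]: "inflate d [] = []"
  and inflate_Cons: "inflate d (x # xs) = map (Pair x) [0..<Suc (d x)] @ inflate d xs"
  by (simp_all add: inflate_def)

lemma set_inflate: "set (inflate d xs) = Sigma (set xs) (\<lambda>x. {..d x})"
  by (induction xs) (auto simp: inflate_Cons simp del: upt_Suc)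

lemma distinct_inflate: "distinct xs \<Longrightarrow> distinct (inflate d xs)"
  by (induction xs) (auto simp: inflate_Cons set_inflate distinct_map inj_on_def simp del: upt_Suc)

text \<open>The entries with second component 0 spell out the original list.\<close>

lemma inj_inflate: "inj (inflate d)"
proof (rule inj_on_inverseI[where g = "\<lambda>zs. map fst (filter (\<lambda>z. snd z = 0) zs)"])
  fix xs
  show "map fst (filter (\<lambda>z. snd z = 0) (inflate d xs)) = xs"
  proof (induction xs)
    case (Cons x xs)
    have "filter (\<lambda>z. snd z = 0) (map (Pair x) [0..<Suc (d x)]) = [(x, 0)]"
      by (simp add: upt_rec[of 0] filter_map comp_def)
    then show ?case using Cons by (simp add: inflate_Cons del: upt_Suc)
  qed simp
qed

lemma steps_inflate:
  "steps (inflate d xs) \<subseteq>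
    {((x, i), (x, Suc i)) | x i. i < d x} \<union> (\<lambda>(x, y). ((x, d x), (y, 0))) ` steps xs"
    (is "_ \<subseteq> ?U \<union> ?f ` _")
proof (induction xs)
  case (Cons x xs)
  let ?b = "map (Pair x) [0..<Suc (d x)]"
  have b: "steps ?b \<subseteq> ?U"
    by (auto simp: steps_def simp del: upt_Suc)
  show ?case
  proof (cases xs)
    case Nil
    then have "inflate d (x # xs) = ?b" by (simp add: inflate_Cons del: upt_Suc)
    then show ?thesis using b by (simp only: le_supI1)
  next
    case (Cons y ys)
    have ne: "inflate d xs \<noteq> []" "hd (inflate d xs) = (y, 0)"
      by (auto simp: Cons inflate_Cons upt_rec[of 0] simp del: upt_Suc)
    have "last ?b = (x, d x)" by simp
    then have "steps (inflate d (x # xs)) = steps ?b \<union> {?f (x, y)} \<union> steps (inflate d xs)"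
      using ne by (simp add: inflate_Cons steps_append del: upt_Suc)
    also have "\<dots> \<subseteq> ?U \<union> insert (?f (x, y)) (?f ` steps xs)"
    proof (intro Un_least)
      show "steps ?b \<subseteq> ?U \<union> insert (?f (x, y)) (?f ` steps xs)" using b by (rule le_supI1)
      show "steps (inflate d xs) \<subseteq> ?U \<union> insert (?f (x, y)) (?f ` steps xs)"
        using Cons.IH by (rule order_trans) (intro Un_mono subset_insertI order_refl)
    qed simp
    also have "insert (?f (x, y)) (?f ` steps xs) = ?f ` steps (x # xs)" by (simp add: Cons)
    finally show ?thesis .
  qed
qed simp

text \<open>A cycle through an inner vertex of an inflated block must run through the entire block,
  hence is too long; any other cycle projects to the original graph.\<close>

lemma no_cycle_inflate:
  assumes L: "L \<subseteq> permutations_of_set V" and l: "l \<ge> 3"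
    and long: "\<And>x. d x > 0 \<Longrightarrow> d x \<ge> l"
    and det: "\<And>x y z us vs. d x > 0 \<Longrightarrow> us \<in> L \<Longrightarrow> vs \<in> L \<Longrightarrow> (x, y) \<in> steps us \<Longrightarrow> (x, z) \<in> steps vs \<Longrightarrow> y = z"
    and inQ: "\<And>x y us. d x = 0 \<Longrightarrow> us \<in> L \<Longrightarrow> (x, y) \<in> steps us \<Longrightarrow> {x, y} \<in> Q"
    and free: "cycles_in l V Q = {}"
    and xs: "xs \<in> L" and ys: "ys \<in> L"
  shows "\<not> contains_subgraph (Sigma V (\<lambda>x. {..d x}),
    edges (path_graph (inflate d xs)) \<union> edges (path_graph (inflate d ys))) (cycle_graph l)"
proof
  let ?W = "Sigma V (\<lambda>x. {..d x})"
  define U where "U = steps (inflate d xs) \<union> steps (inflate d ys)"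
  define T where "T = steps xs \<union> steps ys"
  assume "contains_subgraph (?W, edges (path_graph (inflate d xs)) \<union> edges (path_graph (inflate d ys))) (cycle_graph l)"
  then obtain \<phi> where inj: "inj_on \<phi> {..<l}" and img: "\<phi> ` {..<l} \<subseteq> ?W"
    and e: "\<And>i. i < l \<Longrightarrow> {\<phi> i, \<phi> (Suc i mod l)} \<in> edges (path_graph (inflate d xs)) \<union> edges (path_graph (inflate d ys))"
    by (elim contains_cycleE) (simp only: fst_conv snd_conv)
  have edge: "(\<phi> i, \<phi> (Suc i mod l)) \<in> U \<or> (\<phi> (Suc i mod l), \<phi> i) \<in> U" if "i < l" for i
    using e[OF that] unfolding edges_path_graph U_def by (auto simp: doubleton_eq_iff)
  have U: "(i < d x \<and> z = (x, Suc i)) \<or> (\<exists>y. i = d x \<and> z = (y, 0) \<and> (x, y) \<in> T)" if "((x, i), z) \<in> U" for x i z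
  proof -
    have "((x, i), z) \<in> {((x, i), (x, Suc i)) | x i. i < d x} \<union> (\<lambda>(x, y). ((x, d x), (y, 0))) ` T"
      using that subsetD[OF steps_inflate[of d xs], of "((x, i), z)"]
        subsetD[OF steps_inflate[of d ys], of "((x, i), z)"]
      unfolding U_def T_def image_Un by blast
    then show ?thesis by auto
  qed
  have detT: "y = z" if "d x > 0" "(x, y) \<in> T" "(x, z) \<in> T" for x y z
    using det[OF that(1)] that(2,3) xs ys unfolding T_def by blast
  have inQT: "{x, y} \<in> Q" if "d x = 0" "(x, y) \<in> T" for x y
    using inQ[OF that(1)] that(2) xs ys unfolding T_def by blast
  \<comment> \<open>A vertex \<open>(x, i)\<close> with \<open>i > 0\<close> has at most one
    successor and one predecessor in the union of the two paths; at the end of a block this is what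
    \<open>det\<close> provides.\<close>
  have up: "b = b'" if "((x, i), b) \<in> U" "((x, i), b') \<in> U" "i > 0" for x i b b'
    using U[OF that(1)] U[OF that(2)] that(3) detT[of x] by auto
  have down: "b = (x, i - 1)" if "(b, (x, i)) \<in> U" "i > 0" for x i b
    using U[of "fst b" "snd b" "(x, i)"] that by (cases b) auto
  define C where "C = \<phi> ` {..<l}"
  have nbrs: "\<exists>b\<in>C. \<exists>b'\<in>C. b \<noteq> b' \<and> ((a, b) \<in> U \<or> (b, a) \<in> U) \<and> ((a, b') \<in> U \<or> (b', a) \<in> U)" if "a \<in> C" for a
  proof -
    from that obtain i where i: "i < l" "a = \<phi> i" by (auto simp: C_def)
    define j where "j = (if i = 0 then l - 1 else i - 1)"
    have j: "j < l" "Suc j mod l = i" using i l by (auto simp: j_def)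
    have si: "Suc i mod l < l" using i by simp
    have "j \<noteq> Suc i mod l" using i(1) l by (cases "Suc i = l") (auto simp: j_def)
    then have "\<phi> j \<noteq> \<phi> (Suc i mod l)" using inj_onD[OF inj, of j "Suc i mod l"] j si by auto
    moreover have "\<phi> j \<in> C" "\<phi> (Suc i mod l) \<in> C" using j si by (auto simp: C_def)
    ultimately show ?thesis using edge[OF i(1)] edge[OF j(1)] unfolding j(2) i(2) by metis
  qed
  \<comment> \<open>A cycle through such a vertex must use both neighbours, so it spreads along the
    block.\<close>
  have cross: "(x, i - 1) \<in> C \<and> (i < d x \<longrightarrow> (x, Suc i) \<in> C)" if xi: "(x, i) \<in> C" and i0: "i > 0" for x i
  proof -
    obtain b b' where b: "b \<in> C" "b' \<in> C" "b \<noteq> b'" "((x, i), b) \<in> U \<or> (b, (x, i)) \<in> U"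
      "((x, i), b') \<in> U \<or> (b', (x, i)) \<in> U"
      using nbrs[OF xi] by blast
    have *: ?thesis if "((x, i), b) \<in> U" "(b', (x, i)) \<in> U" "b \<in> C" "b' \<in> C" for b b'
      using U[OF that(1)] down[OF that(2) i0] that(3,4) by auto
    show ?thesis
      using b *[of b b'] *[of b' b] up[of x i b b'] down[of b x i] down[of b' x i] i0 by blast
  qed
  have base: "i = 0" if "(x, i) \<in> C" for x i
  proof (rule ccontr)
    assume "i \<noteq> 0"
    have dn: "(x, j) \<in> C" if "j \<le> i" for j
      using that
    proof (induction rule: inc_induct)
      case (step j)
      then show ?case using cross[of x "Suc j"] by simp
    qed (rule \<open>(x, i) \<in> C\<close>)
    have id: "i \<le> d x" using that img unfolding C_def by auto
    have "(x, j) \<in> C" if "i \<le> j" "j \<le> d x" for j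
      using that
    proof (induction rule: dec_induct)
      case (step j)
      then show ?case using cross[of x j] \<open>i \<noteq> 0\<close> by simp
    qed (rule \<open>(x, i) \<in> C\<close>)
    \<comment> \<open>The whole block of \<open>d x + 1 > l\<close> vertices would lie on a cycle
      with \<open>l\<close> vertices.\<close>
    with dn have "{x} \<times> {..d x} \<subseteq> C" by auto (metis nat_le_linear)
    then have "card ({x} \<times> {..d x}) \<le> card C" by (intro card_mono) (simp_all add: C_def)
    also have "card C \<le> l" unfolding C_def using card_image_le[of "{..<l}" \<phi>] by simp
    finally have "d x < l" by (simp add: card_cartesian_product)
    moreover have "d x > 0" using id \<open>i \<noteq> 0\<close> by simp
    ultimately show False using long[of x] by simp
  qed
  have base': "snd a = 0" if "a \<in> C" for a
    using base[of "fst a" "snd a"] that by simp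
  have fst_inj: "a = b" if "a \<in> C" "b \<in> C" "fst a = fst b" for a b
    using base'[of a] base'[of b] that by (simp add: prod_eq_iff)
  \<comment> \<open>All cycle vertices have second component 0, so an edge of the cycle that leaves
    \<open>(x, 0)\<close> is not inside a block. This forces \<open>d x = 0\<close>, and the edge
    comes from one in \<open>Q\<close>.\<close>
  have proj: "{fst a, fst b} \<in> Q" if "(a, b) \<in> U" "a \<in> C" "b \<in> C" for a b
  proof -
    have a: "a = (fst a, 0)" using base'[of a] that by (simp add: prod_eq_iff)
    have b: "snd b = 0" using base'[of b] that by simp
    have "((fst a, 0), b) \<in> U" using that(1) a by simp
    from U[OF this] b obtain y where "d (fst a) = 0" "b = (y, 0)" "(fst a, y) \<in> T" by auto
    then show ?thesis using inQT by simp
  qed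
  define zs where "zs = map (\<lambda>i. fst (\<phi> i)) [0..<l]"
  have len: "length zs = l" and nth: "\<And>i. i < l \<Longrightarrow> zs ! i = fst (\<phi> i)" by (simp_all add: zs_def)
  have "distinct zs"
  proof -
    have "inj_on (\<lambda>i. fst (\<phi> i)) {..<l}"
      by (rule inj_onI) (metis C_def fst_inj image_eqI inj inj_onD)
    then show ?thesis by (simp add: zs_def distinct_map atLeast0LessThan)
  qed
  moreover have "set zs \<subseteq> V"
  proof -
    have "\<phi> i \<in> ?W" if "i < l" for i using img that by blast
    then have "fst (\<phi> i) \<in> V" if "i < l" for i using that by (metis mem_Sigma_iff prod.collapse)
    then show ?thesis by (auto simp: zs_def)
  qed
  moreover have "cycle_edges zs \<subseteq> Q"
  proof
    fix f assume "f \<in> cycle_edges zs"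
    then obtain i where i: "i < l" "f = {zs ! i, zs ! (Suc i mod l)}" unfolding cycle_edges_def len by blast
    have si: "Suc i mod l < l" using i by simp
    have "\<phi> i \<in> C" "\<phi> (Suc i mod l) \<in> C" using i si by (auto simp: C_def)
    then have "{fst (\<phi> i), fst (\<phi> (Suc i mod l))} \<in> Q"
      using edge[OF i(1)] proj[of "\<phi> i" "\<phi> (Suc i mod l)"] proj[of "\<phi> (Suc i mod l)" "\<phi> i"]
      by (auto simp: insert_commute)
    then show "f \<in> Q" using i si by (simp add: nth)
  qed
  ultimately have "zs \<in> cycles_in l V Q" using len by (simp add: cycles_in_def cycle_lists_def)
  then show False using free by simp
qed

lemma pigeonhole_fiber:
  assumes "finite A" "finite R" "R \<noteq> {}" "f ` A \<subseteq> R"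
  shows "\<exists>c\<in>R. card A \<le> card {a \<in> A. f a = c} * card R"
proof (rule ccontr)
  assume "\<not> ?thesis"
  then have "(\<Sum>c\<in>R. card {a \<in> A. f a = c} * card R) < (\<Sum>c\<in>R. card A)"
    using assms(2,3) by (intro sum_strict_mono) (auto simp: not_le)
  moreover have "(\<Sum>c\<in>R. card {a \<in> A. f a = c}) = card A"
    using sum.group[OF assms(1,2,4), of "\<lambda>_. 1::nat"] by simp
  ultimately show False by (simp flip: sum_distrib_right)
qed

text \<open>One edge of each of the \<open>t\<close> cycles is selected. Hamiltonian lists are
  classified by the selected edges they use, with direction, and by their last vertex, which makes
  at most \<open>4 ^ t * card V\<close> classes. In a class of at least average size, all lists
  leave the tails of the used edges in the same way, so \<open>no_cycle_inflate\<close> applies with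
  blocks behind these tails.\<close>

lemma exists_cycle_free_ham_lists:
  fixes V :: "'a set"
  assumes V: "finite V" "V \<noteq> {}" and l: "l \<ge> 3"
    and n: "card V + (2 * card (cycles_in l V Q) + 1) * l \<le> n"
  obtains W and S :: "('a \<times> nat) list set" where "finite W" "card W = n" "S \<subseteq> permutations_of_set W"
    "\<And>xs ys. xs \<in> S \<Longrightarrow> ys \<in> S \<Longrightarrow>
      \<not> contains_subgraph (W, edges (path_graph xs) \<union> edges (path_graph ys)) (cycle_graph l)"
    "card (ham_lists V Q) \<le> card S * (4 ^ card (cycles_in l V Q) * card V)"
proof -
  define C where "C = cycles_in l V Q"
  define t where "t = card C"
  have finC: "finite C" unfolding C_def cycles_in_def using finite_cycle_lists[OF V(1)] by simp
  have C: "length zs = l \<and> set zs \<subseteq> V" if "zs \<in> C" for zs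
    using that by (auto simp: C_def cycles_in_def cycle_lists_def)
  define Bad where "Bad = (\<lambda>zs. {zs ! 0, zs ! 1}) ` C"
  \<comment> \<open>Both orientations, since a list may traverse a selected edge either way.\<close>
  define D where "D = (\<lambda>zs. (zs ! 0, zs ! 1)) ` C \<union> (\<lambda>zs. (zs ! 1, zs ! 0)) ` C"
  have D: "(x, y) \<in> D \<longleftrightarrow> {x, y} \<in> Bad" for x y
    unfolding D_def Bad_def by (auto simp: doubleton_eq_iff)
  have finD: "finite D" using finC by (simp add: D_def)
  have cardD: "card D \<le> 2 * t"
    using card_Un_le[of "(\<lambda>zs. (zs ! 0, zs ! 1)) ` C" "(\<lambda>zs. (zs ! 1, zs ! 0)) ` C"]
      card_image_le[OF finC, of "\<lambda>zs. (zs ! 0, zs ! 1)"] card_image_le[OF finC, of "\<lambda>zs. (zs ! 1, zs ! 0)"]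
    unfolding D_def t_def by linarith
  have DV: "fst ` D \<subseteq> V"
  proof -
    have "zs ! 0 \<in> V \<and> zs ! 1 \<in> V" if "zs \<in> C" for zs
    proof -
      have "zs ! 0 \<in> set zs" "zs ! 1 \<in> set zs" using C[OF that] l by (auto intro!: nth_mem)
      then show ?thesis using C[OF that] by blast
    qed
    then show ?thesis unfolding D_def by auto
  qed
  have finH: "finite (ham_lists V Q)" using V(1) by (simp add: ham_lists_def)
  have H: "distinct xs" "set xs = V" "edges (path_graph xs) \<subseteq> Q" if "xs \<in> ham_lists V Q" for xs
    using that by (auto simp: ham_lists_def permutations_of_set_def)
  have "last xs \<in> V" if "xs \<in> ham_lists V Q" for xs
    using H(2)[OF that] V(2) last_in_set[of xs] by auto
  then have "(\<lambda>xs. (steps xs \<inter> D, last xs)) ` ham_lists V Q \<subseteq> Pow D \<times> V" by auto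
  from pigeonhole_fiber[OF finH _ _ this] obtain X v where X: "X \<subseteq> D" and v: "v \<in> V"
    and big: "card (ham_lists V Q) \<le>
      card {xs \<in> ham_lists V Q. (steps xs \<inter> D, last xs) = (X, v)} * card (Pow D \<times> V)"
    using finD V by auto
  define L where "L = {xs \<in> ham_lists V Q. (steps xs \<inter> D, last xs) = (X, v)}"
  define D0 where "D0 = fst ` X - {v}"
  have finX: "finite X" using X finD finite_subset by blast
  have "card D0 \<le> card (fst ` X)" unfolding D0_def using finX by (intro card_mono) auto
  also have "\<dots> \<le> card X" using finX by (rule card_image_le)
  also have "\<dots> \<le> card D" using X finD by (rule card_mono[rotated])
  finally have "card D0 \<le> 2 * t" using cardD by simp
  then have "card D0 * l \<le> 2 * t * l" by simp
  \<comment> \<open>Padding to exactly \<open>n\<close> vertices. It goes behind the common last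
    vertex \<open>v\<close>, which no edge leaves. The \<open>+ 1\<close> in the assumed bound on
    \<open>n\<close> leaves at least \<open>l\<close> vertices for it, as
    \<open>no_cycle_inflate\<close> demands of every nontrivial block.\<close>
  define s where "s = n - card V - card D0 * l"
  have s: "l \<le> s" "card V + card D0 * l + s = n"
  proof -
    have "card V + (2 * t * l + l) \<le> n" using n unfolding t_def C_def by simp
    then show "l \<le> s" "card V + card D0 * l + s = n"
      using \<open>card D0 * l \<le> 2 * t * l\<close> unfolding s_def by linarith+
  qed
  define d where "d x = (if x = v then s else if x \<in> D0 then l else 0)" for x
  define W where "W = Sigma V (\<lambda>x. {..d x})"
  have D0V: "D0 \<subseteq> V - {v}" using X DV unfolding D0_def by blast
  have "card W = (\<Sum>x\<in>V. Suc (d x))" using V(1) by (simp add: W_def card_SigmaI)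
  also have "\<dots> = card V + (\<Sum>x\<in>V. d x)" by (simp add: sum_Suc)
  also have "(\<Sum>x\<in>V. d x) = s + (\<Sum>x\<in>V - {v}. d x)"
    using V(1) v by (simp add: sum.remove[of V v] d_def)
  also have "(\<Sum>x\<in>V - {v}. d x) = (\<Sum>x\<in>V - {v}. if x \<in> D0 then l else 0)"
    by (intro sum.cong) (auto simp: d_def)
  also have "\<dots> = card D0 * l"
  proof -
    have "(V - {v}) \<inter> D0 = D0" using D0V by blast
    then show ?thesis using V(1) by (simp add: sum.If_cases)
  qed
  finally have cardW: "card W = n" using s(2) by simp
  have free: "\<not> contains_subgraph (W, edges (path_graph (inflate d xs)) \<union> edges (path_graph (inflate d ys))) (cycle_graph l)"
    if "xs \<in> L" "ys \<in> L" for xs ys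
    unfolding W_def
  proof (rule no_cycle_inflate[where L = L and Q = "Q - Bad"])
    show "L \<subseteq> permutations_of_set V" by (auto simp: L_def ham_lists_def)
    show "d x \<ge> l" if "d x > 0" for x using that s(1) by (auto simp: d_def split: if_splits)
    show "y = z" if *: "d x > 0" "us \<in> L" "vs \<in> L" "(x, y) \<in> steps us" "(x, z) \<in> steps vs" for x y z us vs
    proof -
      have dist: "distinct us" "distinct vs" using *(2,3) H(1) by (auto simp: L_def)
      have "x \<noteq> v" using *(2,4) last_not_step[OF dist(1), of y] by (auto simp: L_def)
      then have "x \<in> D0" using *(1) by (auto simp: d_def split: if_splits)
      then obtain w where "(x, w) \<in> X" by (auto simp: D0_def)
      then have "(x, w) \<in> steps us" "(x, w) \<in> steps vs" using *(2,3) by (auto simp: L_def)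
      then show ?thesis
        using steps_right_unique[OF dist(1) *(4)] steps_right_unique[OF dist(2) *(5)] by blast
    qed
    show "{x, y} \<in> Q - Bad" if *: "d x = 0" "us \<in> L" "(x, y) \<in> steps us" for x y us
    proof -
      have us: "us \<in> ham_lists V Q" "steps us \<inter> D = X" using *(2) by (auto simp: L_def)
      have "x \<noteq> v" "x \<notin> D0" using *(1) s(1) l by (auto simp: d_def split: if_splits)
      then have "x \<notin> fst ` X" by (simp add: D0_def)
      then have "(x, y) \<notin> X" by force
      then have "(x, y) \<notin> D" using us(2) *(3) by blast
      moreover have "{x, y} \<in> Q" using H(3)[OF us(1)] *(3) by (force simp: edges_path_graph)
      ultimately show ?thesis using D by blast
    qed
    show "cycles_in l V (Q - Bad) = {}"
    proof (rule ccontr)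
      assume "cycles_in l V (Q - Bad) \<noteq> {}"
      then obtain zs where zs: "zs \<in> cycle_lists l V" "cycle_edges zs \<subseteq> Q - Bad" by (auto simp: cycles_in_def)
      then have "zs \<in> C" by (auto simp: C_def cycles_in_def)
      then have "{zs ! 0, zs ! 1} \<in> Bad" unfolding Bad_def by (rule imageI)
      moreover have "{zs ! 0, zs ! 1} \<in> cycle_edges zs"
        unfolding cycle_edges_def using C[OF \<open>zs \<in> C\<close>] l by (intro image_eqI[of _ _ 0]) auto
      ultimately show False using zs(2) by blast
    qed
  qed (use l that in auto)
  show ?thesis
  proof (rule that[of W "inflate d ` L"])
    show "finite W" using V(1) by (simp add: W_def)
    show "card W = n" by (rule cardW)
    show "inflate d ` L \<subseteq> permutations_of_set W"
      using H by (auto simp: L_def permutations_of_set_def set_inflate distinct_inflate W_def)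
    show "\<not> contains_subgraph (W, edges (path_graph xs) \<union> edges (path_graph ys)) (cycle_graph l)"
      if "xs \<in> inflate d ` L" "ys \<in> inflate d ` L" for xs ys
      using that free by blast
    have "card (inflate d ` L) = card L" by (rule card_image[OF inj_on_subset[OF inj_inflate subset_UNIV]])
    moreover have "card (Pow D \<times> V) \<le> 4 ^ t * card V"
    proof -
      have "(2::nat) ^ card D \<le> 2 ^ (2 * t)" using cardD by (intro power_increasing) auto
      then show ?thesis using finD by (simp add: card_cartesian_product card_Pow power_mult)
    qed
    ultimately show "card (ham_lists V Q) \<le> card (inflate d ` L) * (4 ^ card (cycles_in l V Q) * card V)"
      using big unfolding L_def[symmetric] t_def C_def by (metis le_trans mult_le_mono2)
  qed
qed

section \<open>Asymptotics\<close>

text \<open>Three bounds are chained: some graph with at most \<open>t\<close> cycles has at least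
  \<open>fact m * p ^ (m - 1) / 2\<close> Hamiltonian lists, subdivision keeps at least one in
  \<open>4 ^ t * m\<close> of them on exactly \<open>n\<close> vertices, and \<open>H\<close> times
  the number kept is at most \<open>fact n\<close>.\<close>

lemma H_cycle_mult_le:
  fixes p :: real
  assumes p: "0 < p" "p < 1" and l: "l \<ge> 3" and m: "m \<ge> 1"
    and t: "2 * (real l * (2 + real m * p) ^ l) \<le> real t" and n: "m + (2 * t + 1) * l \<le> n"
  shows "real (H n (cycle_graph l)) * (fact m * p ^ (m - 1)) \<le> 2 * 4 ^ t * real m * fact n"
proof -
  obtain Q where Q: "real (card (cycles_in l {..<m} Q)) < 2 * (real l * (2 + real m * p) ^ l)"
    "fact m * p ^ (m - 1) \<le> 2 * real (card (ham_lists {..<m} Q))"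
    using exists_graph_few_cycles_many_ham_lists[of "{..<m}" p l] p l by auto
  let ?c = "card (cycles_in l {..<m} Q)"
  have c: "?c \<le> t" using Q(1) t by linarith
  have "(2 * ?c + 1) * l \<le> (2 * t + 1) * l" using c by (intro mult_right_mono) auto
  then have "card {..<m} + (2 * ?c + 1) * l \<le> n" using n unfolding card_lessThan by linarith
  then obtain W and S :: "(nat \<times> nat) list set" where S: "finite W" "card W = n" "S \<subseteq> permutations_of_set W"
    "\<And>xs ys. xs \<in> S \<Longrightarrow> ys \<in> S \<Longrightarrow>
      \<not> contains_subgraph (W, edges (path_graph xs) \<union> edges (path_graph ys)) (cycle_graph l)"
    and card: "card (ham_lists {..<m} Q) \<le> card S * (4 ^ ?c * card {..<m})"
    using exists_cycle_free_ham_lists[of "{..<m}" l Q n] m l by (metis finite_lessThan lessThan_empty_iff not_one_le_zero)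
  have HS: "H n (cycle_graph l) * card S \<le> fact n"
    by (rule H_mult_card_le_fact[OF S])
  have "card S * (4 ^ ?c * card {..<m}) \<le> card S * (4 ^ t * m)"
    using c by (intro mult_left_mono mult_mono power_increasing) auto
  with card have "real (card (ham_lists {..<m} Q)) \<le> real (card S * (4 ^ t * m))"
    by (simp only: of_nat_le_iff)
  then have "fact m * p ^ (m - 1) \<le> 2 * (real (card S) * (4 ^ t * real m))"
    using Q(2) by simp
  then have "real (H n (cycle_graph l)) * (fact m * p ^ (m - 1)) \<le>
      real (H n (cycle_graph l)) * (2 * (real (card S) * (4 ^ t * real m)))"
    by (intro mult_left_mono) auto
  also have "\<dots> = 2 * 4 ^ t * real m * real (H n (cycle_graph l) * card S)" by simp
  also have "\<dots> \<le> 2 * 4 ^ t * real m * fact n"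
  proof (rule mult_left_mono)
    show "real (H n (cycle_graph l) * card S) \<le> fact n"
      using HS by (metis of_nat_fact of_nat_le_iff)
  qed simp
  finally show ?thesis .
qed

text \<open>The quotient of \<open>n ^ n\<close> by \<open>fact n\<close> is a single term of the
  exponential series at \<open>n\<close>.\<close>

lemma ln_fact_ge:
  assumes "n \<ge> 1"
  shows "real n * ln (real n) - real n \<le> ln (fact n)"
proof -
  have "real n ^ n / fact n \<le> exp (real n)"
  proof -
    have "(\<Sum>i\<in>{n}. real n ^ i /\<^sub>R fact i) \<le> (\<Sum>i. real n ^ i /\<^sub>R fact i)"
      by (rule sum_le_suminf[OF summable_exp_generic]) auto
    then show ?thesis by (simp add: exp_def divide_inverse mult.commute)
  qed
  then have "real n ^ n \<le> exp (real n) * fact n" by (simp add: field_simps)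
  then have "ln (real n ^ n) \<le> ln (exp (real n) * fact n)" using assms by (subst ln_le_cancel_iff) auto
  then show ?thesis using assms by (simp add: ln_mult ln_realpow)
qed

lemma ln_fact_le:
  assumes "n \<ge> 1"
  shows "ln (fact n) \<le> real n * ln (real n)"
proof -
  have "(fact n :: real) \<le> real n ^ n" using fact_le_power[of n] by simp
  then have "ln (fact n) \<le> ln (real n ^ n)" using assms by (subst ln_le_cancel_iff) auto
  then show ?thesis using assms by (simp add: ln_realpow)
qed

lemma H_cycle_lower:
  assumes "k \<ge> 2"
  shows "\<exists>f. f \<in> o(\<lambda>n. real n) \<and>
    (\<forall>\<^sub>F n in sequentially. real n powr (1 / real k * real n - f n) \<le> real (H n (cycle_graph (2 * k))))"
proof -
  define a where "a = 1 / real k"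
  have a: "a > 0" using assms by (simp add: a_def)
  \<comment> \<open>A lower bound for \<open>ln (fact N)\<close>, valid as
    \<open>a * n - 2 \<le> N \<le> a * n\<close> for the number \<open>N\<close> of blocks. The
    error term \<open>f\<close> is chosen to make \<open>n powr (a * n - f n)\<close> equal to
    \<open>exp (X n)\<close>.\<close>
  define X where "X n = (a * real n - 2) * ln (a * real n - 2) - a * real n" for n :: nat
  define f where "f n = a * real n - X n / ln (real n)" for n :: nat
  have "((\<lambda>n. f n / real n) \<longlongrightarrow> 0) sequentially"
    unfolding f_def X_def using a by real_asymp
  then have "f \<in> o(\<lambda>n. real n)"
    by (intro smalloI_tendsto) (auto intro: eventually_mono[OF eventually_gt_at_top[of 0]])
  moreover have "\<forall>\<^sub>F n in sequentially. a * real n - 2 \<ge> 1" using a by real_asymp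
  then have "\<forall>\<^sub>F n in sequentially. real n powr (1 / real k * real n - f n) \<le> real (H n (cycle_graph (2 * k)))"
    using eventually_ge_at_top[of 2]
  proof eventually_elim
    case (elim n)
    define N where "N = (n - 1) div k"
    have "n - 1 = k * N + (n - 1) mod k" by (simp add: N_def)
    moreover have "(n - 1) mod k < k" using assms by simp
    ultimately have N: "k * N < n" "n \<le> k * N + k" using elim by linarith+
    have "real n \<le> real k * real N + real k" using N(2) by (metis of_nat_add of_nat_le_iff of_nat_mult)
    then have N1: "a * real n - 2 \<le> real N" using assms by (simp add: a_def field_simps)
    have "real k * real N \<le> real n" using N(1) by (metis less_imp_le of_nat_le_iff of_nat_mult)
    then have N2: "real N \<le> a * real n" using assms by (simp add: a_def field_simps)
    have "(a * real n - 2) * ln (a * real n - 2) \<le> real N * ln (real N)"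
      using N1 elim by (intro mult_mono) auto
    moreover have "N \<ge> 1" using N1 elim by linarith
    ultimately have "X n \<le> ln (fact N)" using ln_fact_ge[of N] N2 unfolding X_def by linarith
    have "1 / real k * real n - f n = X n / ln (real n)" by (simp add: f_def a_def)
    then have "real n powr (1 / real k * real n - f n) = exp (X n)"
      using elim by (simp add: powr_def)
    also have "\<dots> \<le> exp (ln (fact N))" using \<open>X n \<le> ln (fact N)\<close> by (simp only: exp_le_cancel_iff)
    also have "\<dots> = fact N" by simp
    also have "\<dots> \<le> real (H n (cycle_graph (2 * k)))"
      using fact_le_H_cycle[OF assms N(1)] by (metis of_nat_fact of_nat_le_iff)
    finally show ?case .
  qed
  ultimately show ?thesis by blast
qed

lemma H_cycle_upper:
  assumes "k \<ge> 2"
  shows "\<exists>g. g \<in> o(\<lambda>n. real n) \<and>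
    (\<forall>\<^sub>F n in sequentially. real (H n (cycle_graph (2 * k))) \<le> real n powr ((1 - 1 / (3 * real k)) * real n + g n))"
proof -
  \<comment> \<open>With \<open>p = n powr (\<delta> - 1)\<close> the average degree is about
    \<open>n powr \<delta>\<close>, and its power \<open>2 * k\<close>, which governs the number of
    cycles, is \<open>n powr (2/3)\<close>.\<close>
  define \<delta> where "\<delta> = 1 / (3 * real k)"
  have \<delta>: "0 < \<delta>" "\<delta> < 1" using assms by (auto simp: \<delta>_def)
  \<comment> \<open>\<open>K\<close> collects the 2 in \<open>2 * B\<close>, the
    \<open>2 * k\<close> rotations and \<open>3 ^ (2 * k) = 9 ^ k\<close>.\<close>
  define K where "K = 4 * real k * 9 ^ k"
  have K: "K > 0" using assms by (simp add: K_def)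
  \<comment> \<open>A lower bound for the number \<open>m\<close> of vertices before subdivision,
    with 1 for rounding. The exponent 3/4 lies strictly between 2/3, the order of the number of
    subdividing vertices, and 1.\<close>
  define M where "M n = real n - real n powr (3/4) - 1" for n :: nat
  \<comment> \<open>Eventually an upper bound for \<open>ln H\<close>. The two factorials cancel up
    to lower order than \<open>n * ln n\<close>; the main term
    \<open>(1 - \<delta>) * n * ln n\<close> stems from \<open>p ^ (m - 1)\<close>.\<close>
  define X where "X n = ln 2 + (K * real n powr (2/3) + 1) * ln 4 + ln (real n) + real n * ln (real n)
    - (M n * ln (M n) - real n) + (1 - \<delta>) * real n * ln (real n)" for n :: nat
  define g where "g n = X n / ln (real n) - (1 - \<delta>) * real n" for n :: nat
  have "((\<lambda>n. g n / real n) \<longlongrightarrow> 0) sequentially"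
    unfolding g_def X_def M_def using \<delta> K by real_asymp
  then have g: "g \<in> o(\<lambda>n. real n)"
    by (intro smalloI_tendsto) (auto intro: eventually_mono[OF eventually_gt_at_top[of 0]])
  have "\<forall>\<^sub>F n in sequentially. (2 * (K * real n powr (2/3) + 1) + 1) * (2 * real k) \<le> real n powr (3/4)"
    using K assms by real_asymp
  moreover have "\<forall>\<^sub>F n in sequentially. M n \<ge> 1" unfolding M_def by real_asymp
  ultimately have "\<forall>\<^sub>F n in sequentially. real (H n (cycle_graph (2 * k))) \<le> real n powr ((1 - 1 / (3 * real k)) * real n + g n)"
    using eventually_ge_at_top[of 2]
  proof eventually_elim
    case (elim n)
    let ?H = "real (H n (cycle_graph (2 * k)))"
    define q where "q = nat \<lceil>real n powr (3/4)\<rceil>"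
    define t where "t = nat \<lceil>K * real n powr (2/3)\<rceil>"
    define m where "m = n - q"
    define p where "p = real n powr (\<delta> - 1)"
    have n1: "real n > 1" using elim by simp
    have q: "real n powr (3/4) \<le> real q" "real q \<le> real n powr (3/4) + 1"
      unfolding q_def by (auto simp: of_nat_ceiling)
    have t: "K * real n powr (2/3) \<le> real t" "real t \<le> K * real n powr (2/3) + 1"
      unfolding t_def using K by (auto simp: of_nat_ceiling)
    have qn: "q \<le> n" using q(2) elim unfolding M_def by linarith
    then have m: "real m = real n - real q" "m + q = n" by (auto simp: m_def)
    have mM: "M n \<le> real m" using m q by (simp add: M_def)
    have m1: "m \<ge> 1" using mM elim by linarith
    have p: "0 < p" "p < 1" using n1 \<delta> by (auto simp: p_def powr_less_one)
    have "real ((2 * t + 1) * (2 * k)) = (2 * real t + 1) * (2 * real k)"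
      by (simp add: algebra_simps)
    also have "\<dots> \<le> (2 * (K * real n powr (2/3) + 1) + 1) * (2 * real k)"
      using t(2) by (intro mult_right_mono) auto
    also have "\<dots> \<le> real q" using elim q(1) by linarith
    finally have nq: "m + (2 * t + 1) * (2 * k) \<le> n" using m(2) by linarith
    have "real m * p \<le> real n * p" using m(2) p by (intro mult_right_mono) auto
    also have "\<dots> = real n powr \<delta>" using n1 by (simp add: p_def powr_diff)
    finally have "2 + real m * p \<le> 3 * real n powr \<delta>"
      using ge_one_powr_ge_zero[of "real n" \<delta>] n1 \<delta> by linarith
    then have "(2 + real m * p) ^ (2 * k) \<le> (3 * real n powr \<delta>) ^ (2 * k)"
      using p by (intro power_mono) auto
    also have "\<dots> = 9 ^ k * real n powr (2/3)"
    proof -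
      have "(real n powr \<delta>) ^ (2 * k) = real n powr (\<delta> * real (2 * k))"
        using n1 by (simp add: powr_realpow[symmetric] powr_powr)
      also have "\<delta> * real (2 * k) = 2/3" using assms by (simp add: \<delta>_def)
      finally show ?thesis by (simp add: power_mult_distrib power_mult)
    qed
    finally have "2 * (real (2 * k) * (2 + real m * p) ^ (2 * k)) \<le> 2 * (real (2 * k) * (9 ^ k * real n powr (2/3)))"
      by (intro mult_left_mono) auto
    also have "\<dots> = K * real n powr (2/3)" by (simp add: K_def)
    also have "\<dots> \<le> real t" by (rule t(1))
    finally have tB: "2 * (real (2 * k) * (2 + real m * p) ^ (2 * k)) \<le> real t" .
    have main: "?H * (fact m * p ^ (m - 1)) \<le> 2 * 4 ^ t * real m * fact n"
      by (rule H_cycle_mult_le[OF p _ m1 tB nq]) (use assms in simp)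
    \<comment> \<open>The construction with no blocks gives \<open>H \<ge> 1\<close>, so logarithms
      may be taken.\<close>
    have "fact 0 \<le> H n (cycle_graph (2 * k))" using fact_le_H_cycle[of k 0 n] assms elim by simp
    then have H1: "?H > 0" by simp
    have "ln (?H * (fact m * p ^ (m - 1))) \<le> ln (2 * 4 ^ t * real m * fact n)"
      using main H1 p m1 by (subst ln_le_cancel_iff) auto
    moreover have "ln (?H * (fact m * p ^ (m - 1))) = ln ?H + (ln (fact m) + real (m - 1) * ln p)"
      using H1 p by (simp add: ln_mult ln_realpow)
    moreover have "ln (2 * 4 ^ t * real m * fact n) = ln 2 + real t * ln 4 + ln (real m) + ln (fact n)"
      using m1 by (simp add: ln_mult ln_realpow)
    moreover have "real t * ln 4 \<le> (K * real n powr (2/3) + 1) * ln 4"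
      using t(2) by (intro mult_right_mono) auto
    moreover have "ln (real m) \<le> ln (real n)" using m1 m(2) by simp
    moreover have "ln (fact n) \<le> real n * ln (real n)" using ln_fact_le[of n] elim by simp
    moreover have "M n * ln (M n) - real n \<le> ln (fact m)"
    proof -
      have "M n * ln (M n) \<le> real m * ln (real m)" using mM elim by (intro mult_mono) auto
      then show ?thesis using ln_fact_ge[OF m1] m(2) by linarith
    qed
    moreover have "- (real (m - 1) * ln p) \<le> (1 - \<delta>) * real n * ln (real n)"
    proof -
      have "- (real (m - 1) * ln p) = real (m - 1) * ((1 - \<delta>) * ln (real n))"
        using n1 by (simp add: p_def ln_powr algebra_simps)
      also have "\<dots> \<le> real n * ((1 - \<delta>) * ln (real n))"
        using m(2) \<delta> n1 by (intro mult_right_mono) auto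
      finally show ?thesis by (simp add: algebra_simps)
    qed
    ultimately have "ln ?H \<le> X n" unfolding X_def by linarith
    have "?H = exp (ln ?H)" using H1 by simp
    also have "\<dots> \<le> exp (X n)" using \<open>ln ?H \<le> X n\<close> by simp
    also have "\<dots> = real n powr (X n / ln (real n))" using n1 by (simp add: powr_def)
    also have "X n / ln (real n) = (1 - 1 / (3 * real k)) * real n + g n" by (simp add: g_def \<delta>_def)
    finally show ?case .
  qed
  with g show ?thesis by blast
qed

theorem theorem1p7:
  fixes k :: nat
  assumes "k > 2"
  shows "\<exists>f g :: nat \<Rightarrow> real. f \<in> o(\<lambda>n. real n) \<and> g \<in> o(\<lambda>n. real n) \<and>
    (\<forall>\<^sub>F n in sequentially.
       real n powr (1 / real k * real n - f n) \<le> real (H n (cycle_graph (2 * k))) \<and>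
       real (H n (cycle_graph (2 * k))) \<le> real n powr ((1 - 1 / (3 * real k)) * real n + g n))"
proof -
  have "k \<ge> 2" using assms by simp
  from H_cycle_lower[OF this] H_cycle_upper[OF this] show ?thesis
    unfolding eventually_conj_iff by blast
qed

end
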